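(* Let $C>16$ be a real number and let $n\ge 9C$ be an integer. Let $f:\mathbb{N}\to\mathbb{R}$ be defined by $f(k)=Ck$ for all $k$. Then every $n$-vertex $f$-connected graph is $\lfloor C/16\rfloor$-rigid.
   Context: All graphs are finite and simple. Let $f:\mathbb{N}\to\mathbb{R}$, where $\mathbb{N}=\{1,2,\dots\}$. A graph $G=(V,E)$ is $f$-connected if, for every $A,B\subsetneq V$ such that $A\cup B=V$ and $G$ has no edges between $A\setminus B$ and $B\setminus A$, the inequality $$|A\cap B|\ge f\bigl(\min\{|A\setminus B|,|B\setminus A|\}\bigr)$$ holds. Rigidity: a $d$-dimensional framework is a pair $(G,\mathbf{p})$ where $G=(V,E)$ is a graph and $\mathbf{p}:V\to\mathbb{R}^d$. It is rigid if every continuous motion of the vertices starting at $\mathbf{p}$ that preserves the lengths of all edges preserves the distances between all pairs of vertices. The map $\mathbf{p}$ is generic if the $d|V|$ coordinates of the points $\mathbf{p}(v)$, $v\in V$, are algebraically independent over $\mathbb{Q}$. For $d\ge 1$, $G$ is $d$-rigid if $(G,\mathbf{p})$ is rigid for a generic $\mathbf{p}:V\to\mathbb{R}^d$ (this does not depend on the choice of generic $\mathbf{p}$). By convention every graph is $0$-rigid. *)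

theory Defs
  imports "HOL-Analysis.Analysis" "HOL-Library.Poly_Mapping"
begin

definition simple_graph :: "'a set \<Rightarrow> 'a set set \<Rightarrow> bool" where
  "simple_graph V E \<longleftrightarrow> finite V \<and> (\<forall>e\<in>E. e \<subseteq> V \<and> card e = 2)"

text \<open>The function f is only meant on the positive integers. Its value at 0 is never used below:
  as A and B are proper subsets of V = A \<union> B, both differences are nonempty.\<close>

definition f_connected :: "(nat \<Rightarrow> real) \<Rightarrow> 'a set \<Rightarrow> 'a set set \<Rightarrow> bool" where
  "f_connected f V E \<longleftrightarrow>
     (\<forall>A B. A \<subset> V \<and> B \<subset> V \<and> A \<union> B = V \<and> (\<forall>u\<in>A - B. \<forall>v\<in>B - A. {u, v} \<notin> E) \<longrightarrow>
        real (card (A \<inter> B)) \<ge> f (min (card (A - B)) (card (B - A))))"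

text \<open>The dimension d varies with the other data of a statement, so a point of d-dimensional space is
  represented by a function on the natural numbers, of which only the coordinates below d are
  relevant.\<close>

definition edist :: "nat \<Rightarrow> (nat \<Rightarrow> real) \<Rightarrow> (nat \<Rightarrow> real) \<Rightarrow> real" where
  "edist d x y = L2_set (\<lambda>i. x i - y i) {..<d}"

definition continuous_motion ::
    "nat \<Rightarrow> 'a set \<Rightarrow> ('a \<Rightarrow> nat \<Rightarrow> real) \<Rightarrow> (real \<Rightarrow> 'a \<Rightarrow> nat \<Rightarrow> real) \<Rightarrow> bool" where
  "continuous_motion d V p q \<longleftrightarrow>
     (\<forall>v\<in>V. \<forall>i<d. continuous_on {0..1} (\<lambda>t. q t v i) \<and> q 0 v i = p v i)"

definition rigid_framework ::
    "nat \<Rightarrow> 'a set \<Rightarrow> 'a set set \<Rightarrow> ('a \<Rightarrow> nat \<Rightarrow> real) \<Rightarrow> bool" where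
  "rigid_framework d V E p \<longleftrightarrow>
     (\<forall>q. continuous_motion d V p q \<and>
          (\<forall>t\<in>{0..1}. \<forall>u\<in>V. \<forall>v\<in>V. {u, v} \<in> E \<longrightarrow> edist d (q t u) (q t v) = edist d (p u) (p v)) \<longrightarrow>
          (\<forall>t\<in>{0..1}. \<forall>u\<in>V. \<forall>v\<in>V. edist d (q t u) (q t v) = edist d (p u) (p v)))"

text \<open>A multivariate polynomial over the rationals with variables of type 'i is a finitely supported
  map from monomials (finitely supported exponent vectors) to coefficients.\<close>

definition rat_mpoly_eval :: "('i \<Rightarrow> real) \<Rightarrow> (('i \<Rightarrow>\<^sub>0 nat) \<Rightarrow>\<^sub>0 rat) \<Rightarrow> real" where
  "rat_mpoly_eval x P =
     (\<Sum>m\<in>Poly_Mapping.keys P. of_rat (Poly_Mapping.lookup P m) *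
        (\<Prod>i\<in>Poly_Mapping.keys m. x i ^ Poly_Mapping.lookup m i))"

text \<open>Independence of the family x indexed by I, so in particular x is injective on I.\<close>

definition alg_independent_over_rat :: "'i set \<Rightarrow> ('i \<Rightarrow> real) \<Rightarrow> bool" where
  "alg_independent_over_rat I x \<longleftrightarrow>
     (\<forall>P :: ('i \<Rightarrow>\<^sub>0 nat) \<Rightarrow>\<^sub>0 rat.
        (\<forall>m\<in>Poly_Mapping.keys P. Poly_Mapping.keys m \<subseteq> I) \<and> rat_mpoly_eval x P = 0 \<longrightarrow> P = 0)"

definition generic :: "nat \<Rightarrow> 'a set \<Rightarrow> ('a \<Rightarrow> nat \<Rightarrow> real) \<Rightarrow> bool" where
  "generic d V p \<longleftrightarrow> alg_independent_over_rat (V \<times> {..<d}) (\<lambda>(v, i). p v i)"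

text \<open>Rigidity of a generic framework does not depend on the choice of the generic map, so
  ``for a generic p'' may be read existentially. Every graph is 0-rigid by convention.\<close>

definition d_rigid :: "nat \<Rightarrow> 'a set \<Rightarrow> 'a set set \<Rightarrow> bool" where
  "d_rigid d V E \<longleftrightarrow> d = 0 \<or> (\<exists>p. generic d V p \<and> rigid_framework d V E p)"

end

theory Submission
  imports Defs "Jordan_Normal_Form.Spectral_Radius"
begin

text \<open>Put \<open>d = \<lfloor>C / 16\<rfloor>\<close>. If \<open>X\<close>, \<open>Y\<close> are disjoint, nonempty and nonadjacent, then \<open>f\<close>-connectivity gives
  \<open>|X| + |Y| + 16 d min (|X|, |Y|) \<le> n\<close>; in particular there is no bipartite hole of size \<open>h\<close>, where \<open>h\<close> is
  about \<open>n / 16 d\<close>. Colour the vertices with \<open>2 d + 1\<close> colours, about \<open>n / (2 d + 1) \<ge> 5 h\<close> vertices each, and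
  place colour class \<open>a\<close> at the point \<open>(a, a\<^sup>2, \<dots>, a\<^sup>d)\<close> of the moment curve. Between any two classes the graph
  has a giant component missing fewer than \<open>h\<close> vertices on either side. After deletion of few vertices,
  every remaining vertex lies in the giant components towards at least three quarters of the other colours.
  Then an infinitesimal motion is constant on each colour class, and it is trivial because the complete
  graph on \<open>2 d + 1\<close> points of the moment curve is rigid. So the core is infinitesimally rigid. While vertices
  are missing, the absence of bipartite holes provides one with \<open>d\<close> neighbours in the rigid part; it can be
  added after a small perturbation.

  Infinitesimal rigidity is an open condition, so it also holds at a generic configuration \<open>p\<close>. If \<open>y\<close> is
  close to \<open>p\<close> with the same edge lengths, then \<open>y - p\<close> is an infinitesimal motion of the midpoint framework
  \<open>(p + y) / 2\<close>, hence trivial, so that \<open>y\<close> and \<open>p\<close> are congruent. Connectedness of the time interval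
  concludes.\<close>

subsection \<open>Linear algebra\<close>

text \<open>Full column rank of the matrix \<open>a\<close> with rows \<open>J\<close> and columns
  \<open>I\<close>, phrased as a trivial kernel. Rigidity and affine spanning both take this form,
  so one openness result serves both.\<close>

definition injective_system :: "'i set \<Rightarrow> 'e set \<Rightarrow> ('e \<Rightarrow> 'i \<Rightarrow> real) \<Rightarrow> bool" where
  "injective_system I J a \<longleftrightarrow>
     (\<forall>m. (\<forall>e\<in>J. (\<Sum>i\<in>I. a e i * m i) = 0) \<longrightarrow> (\<forall>i\<in>I. m i = 0))"

lemma left_inverse_of_right_inverse:
  fixes X Y :: "nat \<Rightarrow> nat \<Rightarrow> real"
  assumes "\<And>i k. i < d \<Longrightarrow> k < d \<Longrightarrow> (\<Sum>j<d. X i j * Y j k) = of_bool (i = k)"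
    and "i < d" "k < d"
  shows "(\<Sum>j<d. Y i j * X j k) = of_bool (i = k)"
proof -
  define P where "P = Matrix.mat d d (\<lambda>(i, j). X i j)"
  define Q where "Q = Matrix.mat d d (\<lambda>(i, j). Y i j)"
  have PQ: "P \<in> carrier_mat d d" "Q \<in> carrier_mat d d"
    by (auto simp: P_def Q_def)
  have "P * Q = 1\<^sub>m d"
    using assms(1) by (intro eq_matI) (auto simp: P_def Q_def scalar_prod_def lessThan_atLeast0)
  then have QP: "Q * P = 1\<^sub>m d"
    by (rule mat_mult_left_right_inverse[OF PQ])
  have "(\<Sum>j<d. Y i j * X j k) = (Q * P) $$ (i, k)"
    using assms(2,3) by (auto simp: P_def Q_def scalar_prod_def lessThan_atLeast0)
  then show ?thesis
    using assms(2,3) by (simp add: QP)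
qed

text \<open>Adding \<open>e\<close> times the identity to \<open>X\<close> gives a singular matrix
  only if \<open>- e\<close> is an eigenvalue of \<open>X\<close>. There are finitely many
  eigenvalues, so some \<open>e\<close> in the interval avoids them all.\<close>

lemma small_diagonal_shift_injective:
  fixes X :: "nat \<Rightarrow> nat \<Rightarrow> real"
  assumes "\<delta> > 0"
  obtains e where "0 < e" "e < \<delta>"
    "injective_system {..<d} {..<d} (\<lambda>k i. X k i + (if k = i then e else 0))"
proof -
  define P where "P = Matrix.mat d d (\<lambda>(i, j). X i j)"
  have P: "P \<in> carrier_mat d d"
    by (auto simp: P_def)
  have "finite (uminus ` spectrum P)"
    using card_finite_spectrum(1)[OF P] by simp
  moreover have "infinite {0<..<\<delta>}"
    using assms by simp
  ultimately obtain e where e: "e \<in> {0<..<\<delta>}" "e \<notin> uminus ` spectrum P"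
    by (meson finite_subset subsetI)
  have "injective_system {..<d} {..<d} (\<lambda>k i. X k i + (if k = i then e else 0))"
    unfolding injective_system_def
  proof (intro allI impI ballI)
    fix w :: "nat \<Rightarrow> real" and i
    assume "\<forall>k\<in>{..<d}. (\<Sum>i<d. (X k i + (if k = i then e else 0)) * w i) = 0" and "i \<in> {..<d}"
    then have w: "\<And>k. k < d \<Longrightarrow> (\<Sum>i<d. (X k i + (if k = i then e else 0)) * w i) = 0" and i: "i < d"
      by auto
    define v where "v = Matrix.vec d w"
    have "P *\<^sub>v v = (- e) \<cdot>\<^sub>v v"
    proof (rule eq_vecI)
      fix k assume "k < dim_vec ((- e) \<cdot>\<^sub>v v)"
      then have k: "k < d" by (simp add: v_def)
      have "(\<Sum>i<d. X k i * w i) + e * w k = (\<Sum>i<d. X k i * w i) + (\<Sum>i<d. (if k = i then e else 0) * w i)"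
        using k by (simp add: if_distrib[of "\<lambda>z. z * _"] cong: if_cong)
      also have "\<dots> = 0"
        using w[OF k] by (simp add: sum.distrib ring_distribs)
      finally show "vec_index (P *\<^sub>v v) k = vec_index ((- e) \<cdot>\<^sub>v v) k"
        using k by (simp add: P_def v_def scalar_prod_def lessThan_atLeast0)
    qed (auto simp: P_def v_def)
    moreover have "\<not> eigenvector P v (- e)"
      using e(2) unfolding spectrum_def eigenvalue_def by force
    ultimately have "v = 0\<^sub>v d"
      using P by (auto simp: eigenvector_def v_def)
    then have "vec_index v i = 0"
      using i by simp
    then show "w i = 0"
      using i by (simp add: v_def)
  qed
  then show thesis
    using that[of e] e(1) by simp
qed

text \<open>Gram-Schmidt by induction: \<open>u\<close> is the part of the new vector orthogonal to
  the old ones, \<open>v\<close> the old residual of \<open>m\<close>, and subtracting from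
  \<open>v\<close> its component along \<open>u\<close> gives the new residual.\<close>

lemma orthogonal_projection:
  fixes t :: "'k \<Rightarrow> 'i \<Rightarrow> real"
  assumes "finite K" "finite I"
  shows "\<exists>\<alpha>. \<forall>k\<in>K. (\<Sum>i\<in>I. (m i - (\<Sum>l\<in>K. \<alpha> l * t l i)) * t k i) = 0"
  using assms(1)
proof (induction K arbitrary: m rule: finite_induct)
  case empty
  then show ?case by simp
next
  case (insert k0 K)
  obtain \<beta> where \<beta>: "\<And>k. k \<in> K \<Longrightarrow> (\<Sum>i\<in>I. (t k0 i - (\<Sum>l\<in>K. \<beta> l * t l i)) * t k i) = 0"
    using insert.IH[of "t k0"] by blast
  obtain \<alpha> where \<alpha>: "\<And>k. k \<in> K \<Longrightarrow> (\<Sum>i\<in>I. (m i - (\<Sum>l\<in>K. \<alpha> l * t l i)) * t k i) = 0"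
    using insert.IH[of m] by blast
  define u where "u i = t k0 i - (\<Sum>l\<in>K. \<beta> l * t l i)" for i
  define v where "v i = m i - (\<Sum>l\<in>K. \<alpha> l * t l i)" for i
  \<comment> \<open>If \<open>u\<close> vanishes on \<open>I\<close>, the quotient is 0 because
    division by zero yields 0. Any value would do in that case.\<close>
  define c where "c = (\<Sum>i\<in>I. v i * u i) / (\<Sum>i\<in>I. u i * u i)"
  have uK: "(\<Sum>i\<in>I. u i * t k i) = 0" and vK: "(\<Sum>i\<in>I. v i * t k i) = 0" if "k \<in> K" for k
    using \<alpha>[OF that] \<beta>[OF that] by (simp_all add: u_def v_def)
  have vu: "(\<Sum>i\<in>I. (v i - c * u i) * u i) = 0"
  proof (cases "(\<Sum>i\<in>I. u i * u i) = 0")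
    case True
    then have "u i = 0" if "i \<in> I" for i
      using that \<open>finite I\<close> by (simp add: sum_nonneg_eq_0_iff)
    then show ?thesis by simp
  next
    case False
    then show ?thesis
      unfolding left_diff_distrib sum_subtractf mult.assoc sum_distrib_left[symmetric] by (simp add: c_def)
  qed
  have orthK: "(\<Sum>i\<in>I. (v i - c * u i) * t k i) = 0" if "k \<in> K" for k
    using uK[OF that] vK[OF that]
    by (simp add: left_diff_distrib sum_subtractf mult.assoc flip: sum_distrib_left)
  have "(\<Sum>i\<in>I. (v i - c * u i) * (\<Sum>l\<in>K. \<beta> l * t l i)) = (\<Sum>l\<in>K. \<beta> l * (\<Sum>i\<in>I. (v i - c * u i) * t l i))"
    by (simp add: sum_distrib_left sum.swap[of _ K] algebra_simps)
  then have "(\<Sum>i\<in>I. (v i - c * u i) * (\<Sum>l\<in>K. \<beta> l * t l i)) = 0"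
    using orthK by simp
  moreover have "t k0 i = u i + (\<Sum>l\<in>K. \<beta> l * t l i)" for i
    by (simp add: u_def)
  ultimately have orth0: "(\<Sum>i\<in>I. (v i - c * u i) * t k0 i) = 0"
    using vu by (simp add: ring_distribs sum.distrib sum_subtractf)
  define \<gamma> where "\<gamma> l = (if l = k0 then c else \<alpha> l - c * \<beta> l)" for l
  have "v i - c * u i = m i - (\<Sum>l\<in>insert k0 K. \<gamma> l * t l i)" for i
  proof -
    have "(\<Sum>l\<in>insert k0 K. \<gamma> l * t l i) = c * t k0 i + (\<Sum>l\<in>K. (\<alpha> l - c * \<beta> l) * t l i)"
      using insert.hyps by (simp add: \<gamma>_def, intro sum.cong) auto
    then show ?thesis
      by (simp add: u_def v_def algebra_simps sum_subtractf sum_distrib_left)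
  qed
  then show ?case
    using orthK orth0 by (intro exI[of _ \<gamma>]) auto
qed

text \<open>The residual of a unit vector after projection to the span of the rows
  \<open>x k\<close> is orthogonal to every row, hence zero by injectivity. The resulting
  \<open>z\<close> acts as a dual basis of the rows.\<close>

lemma expand_in_spanning_family:
  fixes x :: "nat \<Rightarrow> nat \<Rightarrow> real"
  assumes "injective_system {..<d} {..<d} x"
  obtains z where "\<And>i l. i < d \<Longrightarrow> l < d \<Longrightarrow> (\<Sum>k<d. z k i * x k l) = of_bool (i = l)"
proof -
  have "\<exists>\<alpha>. \<forall>l<d. (\<Sum>k<d. \<alpha> k * x k l) = of_bool (i = l)" for i
  proof -
    obtain \<alpha> where \<alpha>: "\<And>j. j < d \<Longrightarrow>
        (\<Sum>l<d. (of_bool (i = l) - (\<Sum>k<d. \<alpha> k * x k l)) * x j l) = 0"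
      using orthogonal_projection[of "{..<d}" "{..<d}" "\<lambda>l. of_bool (i = l)" x] by auto
    have "of_bool (i = l) - (\<Sum>k<d. \<alpha> k * x k l) = 0" if "l < d" for l
      using assms[unfolded injective_system_def, rule_format, of "\<lambda>l. of_bool (i = l) - (\<Sum>k<d. \<alpha> k * x k l)" l]
        \<alpha> that by (simp add: mult.commute)
    then have "(\<Sum>k<d. \<alpha> k * x k l) = of_bool (i = l)" if "l < d" for l
      using that by fastforce
    then show ?thesis by blast
  qed
  then have "\<exists>z. \<forall>i. \<forall>l<d. (\<Sum>k<d. z i k * x k l) = of_bool (i = l)"
    by (intro choice allI)
  then obtain z where "\<And>i l. l < d \<Longrightarrow> (\<Sum>k<d. z i k * x k l) = of_bool (i = l)"
    by blast
  then show thesis by (intro that[of "\<lambda>k i. z i k"])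
qed

lemma bounded_family_convergent_subsequence:
  fixes f :: "nat \<Rightarrow> 'i \<Rightarrow> real"
  assumes "finite I" and "\<And>i k. i \<in> I \<Longrightarrow> \<bar>f k i\<bar> \<le> B"
  shows "\<exists>r l. strict_mono (r :: nat \<Rightarrow> nat) \<and> (\<forall>i\<in>I. (\<lambda>k. f (r k) i) \<longlonglongrightarrow> l i)"
  using assms
proof (induction I rule: finite_induct)
  case empty
  then show ?case by (auto intro: exI[of _ id] simp: strict_mono_def)
next
  case (insert j I)
  then obtain r l where r: "strict_mono (r :: nat \<Rightarrow> nat)" and l: "\<forall>i\<in>I. (\<lambda>k. f (r k) i) \<longlonglongrightarrow> l i"
    by auto
  have "bounded (range (\<lambda>k. f (r k) j))"
    using insert.prems by (intro boundedI[of _ B]) auto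
  then obtain y r' where r': "strict_mono (r' :: nat \<Rightarrow> nat)" "((\<lambda>k. f (r k) j) \<circ> r') \<longlonglongrightarrow> y"
    using bounded_imp_convergent_subsequence by blast
  have "(\<lambda>k. f ((r \<circ> r') k) i) \<longlonglongrightarrow> (l(j := y)) i" if "i \<in> insert j I" for i
  proof (cases "i = j")
    case True
    then show ?thesis using r'(2) by (simp add: o_def)
  next
    case False
    then have "(\<lambda>k. f (r k) i) \<longlonglongrightarrow> l i" using l that by auto
    then show ?thesis using LIMSEQ_subseq_LIMSEQ[OF _ r'(1)] False by (fastforce simp: o_def)
  qed
  then show ?case
    using strict_mono_o[OF r r'(1)] by blast
qed

text \<open>Compactness of the unit sphere: otherwise there are matrices converging to
  \<open>a\<close> with unit kernel vectors, and a subsequence of these vectors converges to a unit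
  vector in the kernel of \<open>a\<close>.\<close>

lemma injective_system_open:
  assumes "finite I" and inj: "injective_system I J a"
  shows "\<exists>\<delta>>0. \<forall>b. (\<forall>e\<in>J. \<forall>i\<in>I. \<bar>b e i - a e i\<bar> < \<delta>) \<longrightarrow> injective_system I J b"
proof (rule ccontr)
  assume contra: "\<not> ?thesis"
  define Q where "Q k b m \<longleftrightarrow> (\<forall>e\<in>J. \<forall>i\<in>I. \<bar>b e i - a e i\<bar> < 1 / real (Suc k)) \<and>
      (\<forall>e\<in>J. (\<Sum>i\<in>I. b e i * m i) = 0) \<and> (\<exists>i\<in>I. m i \<noteq> 0)" for k b m
  have "\<exists>p. Q k (fst p) (snd p)" for k
  proof -
    have "1 / real (Suc k) > 0" by simp
    then obtain b where "\<forall>e\<in>J. \<forall>i\<in>I. \<bar>b e i - a e i\<bar> < 1 / real (Suc k)" "\<not> injective_system I J b"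
      using contra by blast
    then obtain m where "Q k b m"
      unfolding injective_system_def Q_def by blast
    then have "Q k (fst (b, m)) (snd (b, m))" by simp
    then show ?thesis by blast
  qed
  then have "\<exists>p. \<forall>k. Q k (fst (p k)) (snd (p k))"
    by (intro choice allI)
  then obtain p where p: "\<And>k. Q k (fst (p k)) (snd (p k))" by blast
  define b m where "b k = fst (p k)" and "m k = snd (p k)" for k
  have b: "\<And>k e i. e \<in> J \<Longrightarrow> i \<in> I \<Longrightarrow> \<bar>b k e i - a e i\<bar> < 1 / real (Suc k)"
    and m: "\<And>k e. e \<in> J \<Longrightarrow> (\<Sum>i\<in>I. b k e i * m k i) = 0" and nz: "\<And>k. \<exists>i\<in>I. m k i \<noteq> 0"
    using p by (auto simp: Q_def b_def m_def)
  define N where "N k = sqrt (\<Sum>i\<in>I. (m k i)\<^sup>2)" for k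
  have N: "N k > 0" for k
  proof -
    obtain i where "i \<in> I" "m k i \<noteq> 0" using nz by blast
    then have "(\<Sum>i\<in>I. (m k i)\<^sup>2) > 0"
      using \<open>finite I\<close> by (intro sum_pos2[of _ i]) auto
    then show ?thesis by (simp add: N_def)
  qed
  define \<mu> where "\<mu> k i = m k i / N k" for k i
  have unit: "(\<Sum>i\<in>I. (\<mu> k i)\<^sup>2) = 1" for k
  proof -
    have "(\<Sum>i\<in>I. (\<mu> k i)\<^sup>2) = (\<Sum>i\<in>I. (m k i)\<^sup>2) / (N k)\<^sup>2"
      by (simp add: \<mu>_def power_divide sum_divide_distrib)
    moreover have "(N k)\<^sup>2 = (\<Sum>i\<in>I. (m k i)\<^sup>2)"
      by (simp add: N_def sum_nonneg)
    ultimately show ?thesis using N[of k] by auto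
  qed
  have "\<bar>\<mu> k i\<bar> \<le> 1" if "i \<in> I" for k i
  proof -
    have "(\<mu> k i)\<^sup>2 \<le> (\<Sum>i\<in>I. (\<mu> k i)\<^sup>2)"
      using that \<open>finite I\<close> by (intro member_le_sum) auto
    then show ?thesis using unit[of k] by (simp add: abs_square_le_1)
  qed
  then obtain r l where r: "strict_mono (r :: nat \<Rightarrow> nat)" and l: "\<And>i. i \<in> I \<Longrightarrow> (\<lambda>k. \<mu> (r k) i) \<longlonglongrightarrow> l i"
    using bounded_family_convergent_subsequence[OF \<open>finite I\<close>, of \<mu> 1] by blast
  have bl: "(\<lambda>k. b (r k) e i) \<longlonglongrightarrow> a e i" if "e \<in> J" "i \<in> I" for e i
  proof -
    have "(\<lambda>k. b k e i - a e i) \<longlonglongrightarrow> 0"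
      using b[OF that] by (intro tendsto_rabs_zero_cancel[OF tendsto_sandwich[OF _ _ tendsto_const LIMSEQ_inverse_real_of_nat]])
        (auto intro!: eventuallyI less_imp_le simp: inverse_eq_divide)
    then show ?thesis
      using LIMSEQ_subseq_LIMSEQ[OF _ r] by (fastforce simp: LIM_zero_iff o_def)
  qed
  have "(\<Sum>i\<in>I. a e i * l i) = 0" if "e \<in> J" for e
  proof -
    have "(\<lambda>k. \<Sum>i\<in>I. b (r k) e i * \<mu> (r k) i) \<longlonglongrightarrow> (\<Sum>i\<in>I. a e i * l i)"
      using bl[OF that] l by (intro tendsto_sum tendsto_mult) auto
    moreover have "(\<Sum>i\<in>I. b (r k) e i * \<mu> (r k) i) = 0" for k
      using m[OF that, of "r k"] by (simp add: \<mu>_def flip: sum_divide_distrib)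
    ultimately show ?thesis by (simp add: LIMSEQ_const_iff)
  qed
  then have l0: "l i = 0" if "i \<in> I" for i
    using inj that unfolding injective_system_def by blast
  have "(\<lambda>k. \<Sum>i\<in>I. (\<mu> (r k) i)\<^sup>2) \<longlonglongrightarrow> (\<Sum>i\<in>I. (l i)\<^sup>2)"
    using l by (intro tendsto_sum tendsto_power) auto
  then show False
    using l0 unit by (simp add: LIMSEQ_const_iff)
qed

subsection \<open>Infinitesimal rigidity\<close>

definition edge_motion :: "nat \<Rightarrow> 'a set \<Rightarrow> 'a set set \<Rightarrow> ('a \<Rightarrow> nat \<Rightarrow> real) \<Rightarrow> ('a \<Rightarrow> nat \<Rightarrow> real) \<Rightarrow> bool" where
  "edge_motion d V E x m \<longleftrightarrow>
     (\<forall>u\<in>V. \<forall>v\<in>V. {u, v} \<in> E \<longrightarrow> (\<Sum>i<d. (x u i - x v i) * (m u i - m v i)) = 0)"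

text \<open>An infinitesimal rotation \<open>A\<close> followed by a translation \<open>c\<close>:
  these are the velocities of families of isometries.\<close>

definition trivial_motion :: "nat \<Rightarrow> 'a set \<Rightarrow> ('a \<Rightarrow> nat \<Rightarrow> real) \<Rightarrow> ('a \<Rightarrow> nat \<Rightarrow> real) \<Rightarrow> bool" where
  "trivial_motion d V x m \<longleftrightarrow>
     (\<exists>A c. (\<forall>i j. A i j = - A j i) \<and> (\<forall>v\<in>V. \<forall>i<d. m v i = (\<Sum>j<d. A i j * x v j) + c i))"

definition inf_rigid :: "nat \<Rightarrow> 'a set \<Rightarrow> 'a set set \<Rightarrow> ('a \<Rightarrow> nat \<Rightarrow> real) \<Rightarrow> bool" where
  "inf_rigid d V E x \<longleftrightarrow> (\<forall>m. edge_motion d V E x m \<longrightarrow> trivial_motion d V x m)"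

text \<open>\<open>b\<close> selects \<open>d + 1\<close> affinely independent points. This is
  recorded separately since infinitesimal rigidity does not imply it: a single edge with distinct
  endpoints in the plane is infinitesimally rigid.\<close>

definition spanning :: "nat \<Rightarrow> 'a set \<Rightarrow> ('a \<Rightarrow> nat \<Rightarrow> real) \<Rightarrow> bool" where
  "spanning d V x \<longleftrightarrow> (\<exists>b. b ` {..d} \<subseteq> V \<and>
     injective_system {..<d} {..<d} (\<lambda>j i. x (b (Suc j)) i - x (b 0) i))"

section \<open>Trivial motions and the extended rigidity matrix\<close>

lemma skew_symmetric_sum:
  fixes A T :: "nat \<Rightarrow> nat \<Rightarrow> real"
  assumes "\<And>i j. A i j = - A j i" "\<And>i j. T i j = T j i"
  shows "(\<Sum>i<d. \<Sum>j<d. A i j * T i j) = 0"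
proof -
  have "(\<Sum>i<d. \<Sum>j<d. A i j * T i j) = (\<Sum>i<d. \<Sum>j<d. A j i * T j i)"
    by (rule sum.swap)
  also have "\<dots> = (\<Sum>i<d. \<Sum>j<d. - (A i j * T i j))"
  proof (intro sum.cong refl)
    fix i j show "A j i * T j i = - (A i j * T i j)"
      using assms(1)[of j i] assms(2)[of j i] by simp
  qed
  also have "\<dots> = - (\<Sum>i<d. \<Sum>j<d. A i j * T i j)"
    by (simp add: sum_negf)
  finally show ?thesis by simp
qed

lemma skew_form_zero:
  fixes A :: "nat \<Rightarrow> nat \<Rightarrow> real"
  assumes "\<And>i j. A i j = - A j i"
  shows "(\<Sum>i<d. w i * (\<Sum>j<d. A i j * w j)) = 0"
proof -
  have "(\<Sum>i<d. w i * (\<Sum>j<d. A i j * w j)) = (\<Sum>i<d. \<Sum>j<d. A i j * (w i * w j))"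
    by (simp add: sum_distrib_left mult.left_commute)
  also have "\<dots> = 0"
    by (rule skew_symmetric_sum[OF assms]) simp
  finally show ?thesis .
qed

lemma trivial_motion_orthogonal:
  assumes "trivial_motion d V x m" "u \<in> V" "v \<in> V"
  shows "(\<Sum>i<d. (x u i - x v i) * (m u i - m v i)) = 0"
proof -
  obtain A c where A: "\<And>i j. A i j = - A j i"
    and m: "\<And>v i. v \<in> V \<Longrightarrow> i < d \<Longrightarrow> m v i = (\<Sum>j<d. A i j * x v j) + c i"
    using assms(1) unfolding trivial_motion_def by blast
  have "(\<Sum>i<d. (x u i - x v i) * (m u i - m v i)) =
      (\<Sum>i<d. (x u i - x v i) * (\<Sum>j<d. A i j * (x u j - x v j)))"
    using assms(2,3) by (intro sum.cong refl) (simp add: m right_diff_distrib sum_subtractf)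
  also have "\<dots> = 0"
    by (rule skew_form_zero[OF A])
  finally show ?thesis .
qed

text \<open>The \<open>Inl\<close> rows form the usual rigidity matrix. The \<open>Inr\<close> rows
  are themselves trivial motions: rotation in the plane of coordinates \<open>i\<close>,
  \<open>j\<close>, or translation along \<open>i\<close> if \<open>j = d\<close>. Lying in their
  kernel means being orthogonal to all trivial motions.\<close>

fun rigidity_row :: "nat \<Rightarrow> ('a \<Rightarrow> nat \<Rightarrow> real) \<Rightarrow> ('a \<times> 'a) + (nat \<times> nat) \<Rightarrow> 'a \<times> nat \<Rightarrow> real" where
  "rigidity_row d x (Inl (u, v)) (w, l) = (of_bool (w = u) - of_bool (w = v)) * (x u l - x v l)"
| "rigidity_row d x (Inr (i, j)) (w, l) =
     (if j = d then of_bool (l = i) else of_bool (l = i) * x w j - of_bool (l = j) * x w i)"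

definition rigidity_rows :: "nat \<Rightarrow> 'a set \<Rightarrow> 'a set set \<Rightarrow> (('a \<times> 'a) + (nat \<times> nat)) set" where
  "rigidity_rows d V E = Inl ` {(u, v). u \<in> V \<and> v \<in> V \<and> {u, v} \<in> E} \<union> Inr ` ({..<d} \<times> {..d})"

lemma rigidity_row_Inl_sum:
  assumes "finite V" "u \<in> V" "v \<in> V"
  shows "(\<Sum>p\<in>V \<times> {..<d}. rigidity_row d x (Inl (u, v)) p * m p) =
    (\<Sum>i<d. (x u i - x v i) * (m (u, i) - m (v, i)))"
proof -
  have "(\<Sum>p\<in>V \<times> {..<d}. rigidity_row d x (Inl (u, v)) p * m p) =
      (\<Sum>i<d. \<Sum>w\<in>V. (of_bool (w = u) - of_bool (w = v)) * (x u i - x v i) * m (w, i))"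
    unfolding sum.cartesian_product' by (subst sum.swap) simp
  also have "\<dots> = (\<Sum>i<d. (x u i - x v i) * (m (u, i) - m (v, i)))"
  proof (rule sum.cong[OF refl])
    fix i
    have "(\<Sum>w\<in>V. (of_bool (w = u) - of_bool (w = v)) * (x u i - x v i) * m (w, i)) =
        (\<Sum>w\<in>V. (if w = u then (x u i - x v i) * m (w, i) else 0) - (if w = v then (x u i - x v i) * m (w, i) else 0))"
      by (intro sum.cong) (auto simp: algebra_simps)
    then show "(\<Sum>w\<in>V. (of_bool (w = u) - of_bool (w = v)) * (x u i - x v i) * m (w, i)) =
        (x u i - x v i) * (m (u, i) - m (v, i))"
      using assms by (simp add: sum_subtractf right_diff_distrib)
  qed
  finally show ?thesis .
qed

lemma rigidity_row_Inr_sum: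
  assumes "finite V" "i < d" "j \<le> d"
  shows "(\<Sum>p\<in>V \<times> {..<d}. rigidity_row d x (Inr (i, j)) p * m p) =
    (\<Sum>w\<in>V. if j = d then m (w, i) else x w j * m (w, i) - x w i * m (w, j))"
proof -
  have "(\<Sum>p\<in>V \<times> {..<d}. rigidity_row d x (Inr (i, j)) p * m p) =
      (\<Sum>w\<in>V. \<Sum>l<d. rigidity_row d x (Inr (i, j)) (w, l) * m (w, l))"
    by (rule sum.cartesian_product')
  also have "\<dots> = (\<Sum>w\<in>V. if j = d then m (w, i) else x w j * m (w, i) - x w i * m (w, j))"
  proof (rule sum.cong[OF refl])
    fix w
    show "(\<Sum>l<d. rigidity_row d x (Inr (i, j)) (w, l) * m (w, l)) =
        (if j = d then m (w, i) else x w j * m (w, i) - x w i * m (w, j))"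
    proof (cases "j = d")
      case True
      then show ?thesis using assms by (simp add: of_bool_def if_distrib[of "\<lambda>z. z * _"] cong: if_cong)
    next
      case False
      have "(\<Sum>l<d. rigidity_row d x (Inr (i, j)) (w, l) * m (w, l)) =
          (\<Sum>l<d. (if l = i then x w j * m (w, l) else 0) - (if l = j then x w i * m (w, l) else 0))"
        using False by (intro sum.cong) auto
      then show ?thesis using assms False by (simp add: sum_subtractf)
    qed
  qed
  finally show ?thesis .
qed

text \<open>Whatever the coefficients, the matrix on the right is skew-symmetric. So projecting to
  the span of the \<open>Inr\<close> rows produces a trivial motion.\<close>

lemma rigidity_row_Inr_combination:
  assumes "l < d"
  shows "(\<Sum>k\<in>{..<d} \<times> {..d}. \<alpha> k * rigidity_row d x (Inr k) (w, l)) =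
    (\<Sum>j<d. (\<alpha> (l, j) - \<alpha> (j, l)) * x w j) + \<alpha> (l, d)"
proof -
  have "(\<Sum>k\<in>{..<d} \<times> {..d}. \<alpha> k * rigidity_row d x (Inr k) (w, l)) =
      (\<Sum>i<d. \<Sum>j\<le>d. \<alpha> (i, j) * rigidity_row d x (Inr (i, j)) (w, l))"
    by (rule sum.cartesian_product')
  also have "\<dots> = (\<Sum>i<d. (\<Sum>j<d. \<alpha> (i, j) * (of_bool (l = i) * x w j - of_bool (l = j) * x w i))
      + \<alpha> (i, d) * of_bool (l = i))"
    by (intro sum.cong refl) (simp add: lessThan_Suc_atMost[symmetric])
  also have "\<dots> = (\<Sum>i<d. if i = l then (\<Sum>j<d. \<alpha> (i, j) * x w j) else 0)
      - (\<Sum>i<d. \<Sum>j<d. if j = l then \<alpha> (i, j) * x w i else 0) + (\<Sum>i<d. if i = l then \<alpha> (i, d) else 0)"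
  proof -
    have "(\<Sum>j<d. \<alpha> (i, j) * (of_bool (l = i) * x w j - of_bool (l = j) * x w i)) + \<alpha> (i, d) * of_bool (l = i)
        = (if i = l then (\<Sum>j<d. \<alpha> (i, j) * x w j) else 0) - (\<Sum>j<d. if j = l then \<alpha> (i, j) * x w i else 0)
          + (if i = l then \<alpha> (i, d) else 0)" for i
    proof -
      have "(\<Sum>j<d. \<alpha> (i, j) * (of_bool (l = i) * x w j - of_bool (l = j) * x w i)) =
          (\<Sum>j<d. (if i = l then \<alpha> (i, j) * x w j else 0) - (if j = l then \<alpha> (i, j) * x w i else 0))"
        by (intro sum.cong) auto
      then show ?thesis by (simp add: sum_subtractf)
    qed
    then show ?thesis by (simp add: sum.distrib sum_subtractf)
  qed
  also have "\<dots> = (\<Sum>j<d. (\<alpha> (l, j) - \<alpha> (j, l)) * x w j) + \<alpha> (l, d)"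
    using assms by (simp add: left_diff_distrib sum_subtractf)
  finally show ?thesis .
qed

text \<open>Adding the trivial motions as rows removes exactly the trivial part of the kernel.
  Rigidity becomes a full rank condition, to which openness applies.\<close>

lemma inf_rigid_iff_injective:
  assumes "finite V"
  shows "inf_rigid d V E x \<longleftrightarrow>
    injective_system (V \<times> {..<d}) (rigidity_rows d V E) (rigidity_row d x)" (is "_ \<longleftrightarrow> ?inj")
proof
  assume rigid: "inf_rigid d V E x"
  show ?inj
    unfolding injective_system_def
  proof (intro allI impI)
    fix m :: "'a \<times> nat \<Rightarrow> real"
    assume ker: "\<forall>e\<in>rigidity_rows d V E. (\<Sum>p\<in>V \<times> {..<d}. rigidity_row d x e p * m p) = 0"
    have "edge_motion d V E x (\<lambda>v i. m (v, i))"
      unfolding edge_motion_def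
    proof (intro ballI impI)
      fix u v assume "u \<in> V" "v \<in> V" "{u, v} \<in> E"
      then show "(\<Sum>i<d. (x u i - x v i) * (m (u, i) - m (v, i))) = 0"
        using ker[rule_format, of "Inl (u, v)"] rigidity_row_Inl_sum[OF assms, of u v d x m]
        by (auto simp: rigidity_rows_def)
    qed
    then obtain A c where A: "\<And>i j. A i j = - A j i"
      and mA: "\<And>v i. v \<in> V \<Longrightarrow> i < d \<Longrightarrow> m (v, i) = (\<Sum>j<d. A i j * x v j) + c i"
      using rigid unfolding inf_rigid_def trivial_motion_def by blast
    have c0: "(\<Sum>w\<in>V. m (w, i)) = 0" if "i < d" for i
      using ker[rule_format, of "Inr (i, d)"] rigidity_row_Inr_sum[OF assms that, of d x m] that
      by (auto simp: rigidity_rows_def)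
    \<comment> \<open>Orthogonality of \<open>m\<close> to the rotations says that \<open>T\<close>
      is symmetric, so its pairing with the skew \<open>A\<close> vanishes. Together with the
      vanishing translation part, this pairing is the squared norm of \<open>m\<close>. The value 0
      beyond \<open>d\<close> makes the symmetry hold for all indices.\<close>
    define T where "T i j = (if i < d \<and> j < d then (\<Sum>w\<in>V. x w j * m (w, i)) else 0)" for i j
    have T: "T i j = T j i" for i j
      using ker[rule_format, of "Inr (i, j)"] rigidity_row_Inr_sum[OF assms, of i d j x m]
      by (auto simp: rigidity_rows_def T_def sum_subtractf)
    have "(\<Sum>p\<in>V \<times> {..<d}. (m p)\<^sup>2) = (\<Sum>i<d. \<Sum>w\<in>V. (m (w, i))\<^sup>2)"
      unfolding sum.cartesian_product' by (rule sum.swap)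
    also have "\<dots> = (\<Sum>i<d. \<Sum>w\<in>V. (\<Sum>j<d. A i j * (x w j * m (w, i))) + c i * m (w, i))"
    proof (intro sum.cong refl)
      fix i w assume "i \<in> {..<d}" "w \<in> V"
      then have "m (w, i) = (\<Sum>j<d. A i j * x w j) + c i" using mA by simp
      then show "(m (w, i))\<^sup>2 = (\<Sum>j<d. A i j * (x w j * m (w, i))) + c i * m (w, i)"
        by (simp add: power2_eq_square ring_distribs mult.assoc flip: sum_distrib_right)
          (simp add: sum_distrib_right sum_distrib_left mult.assoc mult.commute mult.left_commute)
    qed
    also have "\<dots> = (\<Sum>i<d. \<Sum>j<d. A i j * T i j) + (\<Sum>i<d. c i * (\<Sum>w\<in>V. m (w, i)))"
    proof -
      have "(\<Sum>w\<in>V. \<Sum>j<d. A i j * (x w j * m (w, i))) = (\<Sum>j<d. A i j * T i j)" if "i < d" for i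
        using that by (subst sum.swap) (simp add: T_def sum_distrib_left)
      then show ?thesis by (simp add: sum.distrib sum_distrib_left)
    qed
    also have "\<dots> = 0"
      using skew_symmetric_sum[OF A T] c0 by simp
    finally show "\<forall>p\<in>V \<times> {..<d}. m p = 0"
      using assms by (simp add: sum_nonneg_eq_0_iff)
  qed
next
  assume inj: ?inj
  show "inf_rigid d V E x"
    unfolding inf_rigid_def
  proof (intro allI impI)
    fix m assume m: "edge_motion d V E x m"
    let ?K = "{..<d} \<times> {..d}"
    \<comment> \<open>Conversely, an edge motion minus its projection \<open>r\<close> to the
      trivial motions is annihilated by all rows of both kinds, hence zero.\<close>
    obtain \<alpha> where \<alpha>: "\<And>k. k \<in> ?K \<Longrightarrow> (\<Sum>p\<in>V \<times> {..<d}. (m (fst p) (snd p) -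
        (\<Sum>l\<in>?K. \<alpha> l * rigidity_row d x (Inr l) p)) * rigidity_row d x (Inr k) p) = 0"
      using orthogonal_projection[of ?K "V \<times> {..<d}" "\<lambda>p. m (fst p) (snd p)" "\<lambda>k. rigidity_row d x (Inr k)"] assms
      by auto
    define r where "r w l = (\<Sum>j<d. (\<alpha> (l, j) - \<alpha> (j, l)) * x w j) + \<alpha> (l, d)" for w l
    have r: "trivial_motion d V x r"
      unfolding trivial_motion_def
      by (intro exI[of _ "\<lambda>l j. \<alpha> (l, j) - \<alpha> (j, l)"] exI[of _ "\<lambda>l. \<alpha> (l, d)"]) (simp add: r_def)
    define m' where "m' p = m (fst p) (snd p) - r (fst p) (snd p)" for p
    have "\<forall>p\<in>V \<times> {..<d}. m' p = 0"
    proof (rule inj[unfolded injective_system_def, rule_format, THEN ballI])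
      fix e assume "e \<in> rigidity_rows d V E"
      then consider u v where "e = Inl (u, v)" "u \<in> V" "v \<in> V" "{u, v} \<in> E" | k where "e = Inr k" "k \<in> ?K"
        unfolding rigidity_rows_def by blast
      then show "(\<Sum>p\<in>V \<times> {..<d}. rigidity_row d x e p * m' p) = 0"
      proof cases
        case 1
        have "(\<Sum>i<d. (x u i - x v i) * (m u i - m v i)) = 0"
          using m 1 unfolding edge_motion_def by blast
        moreover have "(\<Sum>i<d. (x u i - x v i) * (r u i - r v i)) = 0"
          using trivial_motion_orthogonal[OF r] 1 by blast
        ultimately show ?thesis
          unfolding 1(1) rigidity_row_Inl_sum[OF assms 1(2,3)]
          by (simp add: m'_def algebra_simps sum_subtractf sum.distrib)
      next
        case 2
        have "(\<Sum>p\<in>V \<times> {..<d}. rigidity_row d x e p * m' p) =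
            (\<Sum>p\<in>V \<times> {..<d}. (m (fst p) (snd p) -
              (\<Sum>l\<in>?K. \<alpha> l * rigidity_row d x (Inr l) p)) * rigidity_row d x (Inr k) p)"
          unfolding 2(1)
        proof (rule sum.cong[OF refl])
          fix p assume "p \<in> V \<times> {..<d}"
          then obtain w l where "p = (w, l)" "l < d" by auto
          then show "rigidity_row d x (Inr k) p * m' p = (m (fst p) (snd p) -
              (\<Sum>l\<in>?K. \<alpha> l * rigidity_row d x (Inr l) p)) * rigidity_row d x (Inr k) p"
            by (simp add: m'_def r_def rigidity_row_Inr_combination)
        qed
        then show ?thesis using \<alpha>[OF 2(2)] by simp
      qed
    qed
    then have "m v i = r v i" if "v \<in> V" "i < d" for v i
      using that by (auto simp: m'_def)
    then show "trivial_motion d V x m"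
      using r unfolding trivial_motion_def by auto
  qed
qed

section \<open>Stability of rigidity and spanning under small perturbations\<close>

lemma inf_rigid_open:
  assumes "finite V" "inf_rigid d V E x"
  obtains \<epsilon> where "\<epsilon> > 0"
    "\<And>y. (\<And>v i. v \<in> V \<Longrightarrow> i < d \<Longrightarrow> \<bar>y v i - x v i\<bar> < \<epsilon>) \<Longrightarrow> inf_rigid d V E y"
proof -
  have "finite (V \<times> {..<d})" using assms by simp
  from injective_system_open[OF this] obtain \<delta> where "\<delta> > 0" and \<delta>:
    "\<And>b. (\<forall>e\<in>rigidity_rows d V E. \<forall>p\<in>V \<times> {..<d}. \<bar>b e p - rigidity_row d x e p\<bar> < \<delta>) \<Longrightarrow>
      injective_system (V \<times> {..<d}) (rigidity_rows d V E) b"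
    using assms(2) unfolding inf_rigid_iff_injective[OF assms(1)] by blast
  show thesis
  proof (rule that[of "\<delta> / 2"])
    fix y assume y: "\<And>v i. v \<in> V \<Longrightarrow> i < d \<Longrightarrow> \<bar>y v i - x v i\<bar> < \<delta> / 2"
    have near: "\<bar>rigidity_row d y e p - rigidity_row d x e p\<bar> < \<delta>"
      if "e \<in> rigidity_rows d V E" "p \<in> V \<times> {..<d}" for e p
    proof -
      obtain w l where p: "p = (w, l)" "w \<in> V" "l < d" using \<open>p \<in> _\<close> by auto
      consider u v where "e = Inl (u, v)" "u \<in> V" "v \<in> V" | i j where "e = Inr (i, j)" "i < d" "j \<le> d"
        using \<open>e \<in> _\<close> unfolding rigidity_rows_def by auto
      then show ?thesis
      proof cases
        case 1
        then show ?thesis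
          using y[of u l] y[of v l] p \<open>\<delta> > 0\<close> by (auto simp: abs_if split: if_splits)
      next
        case 2
        then show ?thesis
          using y[of w i] y[of w j] p \<open>\<delta> > 0\<close> by (auto simp: abs_if split: if_splits)
      qed
    qed
    show "inf_rigid d V E y"
      unfolding inf_rigid_iff_injective[OF assms(1)] using near by (intro \<delta>) blast
  qed (use \<open>\<delta> > 0\<close> in simp)
qed

lemma spanning_open:
  assumes "spanning d V x"
  obtains \<epsilon> where "\<epsilon> > 0"
    "\<And>y. (\<And>v i. v \<in> V \<Longrightarrow> i < d \<Longrightarrow> \<bar>y v i - x v i\<bar> < \<epsilon>) \<Longrightarrow> spanning d V y"
proof -
  obtain b where b: "b ` {..d} \<subseteq> V" and inj:
      "injective_system {..<d} {..<d} (\<lambda>j i. x (b (Suc j)) i - x (b 0) i)"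
    using assms unfolding spanning_def by blast
  from injective_system_open[OF finite_lessThan inj] obtain \<delta> where "\<delta> > 0" and \<delta>: "\<And>c.
      (\<forall>j\<in>{..<d}. \<forall>i\<in>{..<d}. \<bar>c j i - (x (b (Suc j)) i - x (b 0) i)\<bar> < \<delta>) \<Longrightarrow>
      injective_system {..<d} {..<d} c"
    by blast
  show thesis
  proof (rule that[of "\<delta> / 2"])
    fix y assume y: "\<And>v i. v \<in> V \<Longrightarrow> i < d \<Longrightarrow> \<bar>y v i - x v i\<bar> < \<delta> / 2"
    have near: "\<bar>(y (b (Suc j)) i - y (b 0) i) - (x (b (Suc j)) i - x (b 0) i)\<bar> < \<delta>"
      if "j \<in> {..<d}" "i \<in> {..<d}" for j i
    proof -
      have "b (Suc j) \<in> V" "b 0 \<in> V" using b that by auto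
      then show ?thesis using y[of "b (Suc j)" i] y[of "b 0" i] that by (auto simp: abs_if split: if_splits)
    qed
    show "spanning d V y"
      unfolding spanning_def
      using b near by (intro exI[of _ b] conjI \<delta>) blast+
  qed (use \<open>\<delta> > 0\<close> in simp)
qed

subsection \<open>From infinitesimal to continuous rigidity\<close>

definition sqdist :: "nat \<Rightarrow> (nat \<Rightarrow> real) \<Rightarrow> (nat \<Rightarrow> real) \<Rightarrow> real" where
  "sqdist d x y = (\<Sum>i<d. (x i - y i)\<^sup>2)"

definition congruent_on :: "nat \<Rightarrow> 'a set \<Rightarrow> ('a \<Rightarrow> nat \<Rightarrow> real) \<Rightarrow> ('a \<Rightarrow> nat \<Rightarrow> real) \<Rightarrow> bool" where
  "congruent_on d V p q \<longleftrightarrow> (\<forall>u\<in>V. \<forall>v\<in>V. sqdist d (p u) (p v) = sqdist d (q u) (q v))"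

lemma edist_eq_iff_sqdist: "edist d x y = edist d x' y' \<longleftrightarrow> sqdist d x y = sqdist d x' y'"
  by (simp add: edist_def L2_set_def sqdist_def)

lemma sqdist_polarization:
  "(\<Sum>i<d. (x i - z i) * (y i - z i)) = (sqdist d x z + sqdist d y z - sqdist d x y) / 2"
proof -
  have "2 * (\<Sum>i<d. (x i - z i) * (y i - z i)) = sqdist d x z + sqdist d y z - sqdist d x y"
    unfolding sqdist_def sum_distrib_left sum_subtractf[symmetric] sum.distrib[symmetric]
    by (intro sum.cong refl) (simp add: power2_eq_square algebra_simps)
  then show ?thesis by simp
qed

text \<open>Congruence makes the Gram matrices of the differences from the base point
  \<open>b 0\<close> agree. A point of \<open>p\<close> is determined by its inner products with a
  basis of such differences, and these can be computed in \<open>q\<close>.\<close>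

lemma congruent_on_isometry:
  assumes span: "spanning d V p" and cong: "congruent_on d V p q"
  obtains L c where "\<And>v i. v \<in> V \<Longrightarrow> i < d \<Longrightarrow> p v i = (\<Sum>j<d. L i j * q v j) + c i"
    and "\<And>w. (\<Sum>i<d. (\<Sum>j<d. L i j * w j)\<^sup>2) = (\<Sum>j<d. (w j)\<^sup>2)"
proof -
  obtain b where b: "b ` {..d} \<subseteq> V"
    and inj: "injective_system {..<d} {..<d} (\<lambda>j i. p (b (Suc j)) i - p (b 0) i)"
    using span unfolding spanning_def by blast
  define x y where "x k i = q (b (Suc k)) i - q (b 0) i"
    and "y k i = p (b (Suc k)) i - p (b 0) i" for k i
  obtain z where z: "\<And>i l. i < d \<Longrightarrow> l < d \<Longrightarrow> (\<Sum>k<d. z k i * y k l) = of_bool (i = l)"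
    using expand_in_spanning_family[OF inj] unfolding y_def by blast
  \<comment> \<open>\<open>z\<close> is dual to the basis \<open>y\<close>, so \<open>L\<close>
    sends a vector to the one whose inner products with the \<open>y k\<close> are the inner
    products of the given vector with the \<open>x k\<close>.\<close>
  define L where "L i j = (\<Sum>k<d. z k i * x k j)" for i j
  define c where "c i = p (b 0) i - (\<Sum>j<d. L i j * q (b 0) j)" for i
  have gram: "(\<Sum>i<d. (q u i - q (b 0) i) * (q v i - q (b 0) i)) =
      (\<Sum>i<d. (p u i - p (b 0) i) * (p v i - p (b 0) i))" if "u \<in> V" "v \<in> V" for u v
    using that cong b unfolding sqdist_polarization congruent_on_def by auto
  have bV: "b (Suc k) \<in> V" if "k < d" for k using b that by auto
  show thesis
  proof (rule that[of L c])
    fix v i assume v: "v \<in> V" and i: "i < d"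
    have "(\<Sum>j<d. L i j * (q v j - q (b 0) j)) = (\<Sum>k<d. z k i * (\<Sum>j<d. x k j * (q v j - q (b 0) j)))"
      unfolding L_def sum_distrib_right sum_distrib_left by (subst sum.swap) (simp add: mult.assoc)
    also have "\<dots> = (\<Sum>k<d. z k i * (\<Sum>j<d. y k j * (p v j - p (b 0) j)))"
      unfolding x_def y_def using v by (intro sum.cong refl arg_cong2[where f = "(*)"] gram bV) auto
    also have "\<dots> = (\<Sum>j<d. (\<Sum>k<d. z k i * y k j) * (p v j - p (b 0) j))"
      unfolding sum_distrib_right sum_distrib_left by (subst sum.swap) (simp add: mult.assoc)
    also have "\<dots> = (\<Sum>j<d. if j = i then p v j - p (b 0) j else 0)"
      using i by (intro sum.cong refl) (simp add: z)
    also have "\<dots> = p v i - p (b 0) i"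
      using i by simp
    finally show "p v i = (\<Sum>j<d. L i j * q v j) + c i"
      by (simp add: c_def right_diff_distrib sum_subtractf)
  next
    fix w :: "nat \<Rightarrow> real"
    have orth: "(\<Sum>j<d. L i j * L k j) = of_bool (i = k)" if "i < d" "k < d" for i k
    proof -
      have "(\<Sum>j<d. L i j * L k j) = (\<Sum>a<d. \<Sum>e<d. z a i * z e k * (\<Sum>j<d. x a j * x e j))"
      proof -
        have "(\<Sum>j<d. L i j * L k j) = (\<Sum>j<d. \<Sum>a<d. \<Sum>e<d. z a i * z e k * (x a j * x e j))"
          unfolding L_def sum_product by (simp add: mult_ac)
        also have "\<dots> = (\<Sum>a<d. \<Sum>j<d. \<Sum>e<d. z a i * z e k * (x a j * x e j))"
          by (rule sum.swap)
        also have "\<dots> = (\<Sum>a<d. \<Sum>e<d. \<Sum>j<d. z a i * z e k * (x a j * x e j))"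
          by (intro sum.cong refl sum.swap)
        finally show ?thesis by (simp add: sum_distrib_left)
      qed
      also have "\<dots> = (\<Sum>a<d. \<Sum>e<d. z a i * z e k * (\<Sum>j<d. y a j * y e j))"
      proof (intro sum.cong refl)
        fix a e assume "a \<in> {..<d}" "e \<in> {..<d}"
        then have "(\<Sum>j<d. x a j * x e j) = (\<Sum>j<d. y a j * y e j)"
          unfolding x_def y_def by (intro gram bV) auto
        then show "z a i * z e k * (\<Sum>j<d. x a j * x e j) = z a i * z e k * (\<Sum>j<d. y a j * y e j)"
          by (rule arg_cong)
      qed
      also have "\<dots> = (\<Sum>j<d. (\<Sum>a<d. z a i * y a j) * (\<Sum>e<d. z e k * y e j))"
      proof -
        have "(\<Sum>j<d. (\<Sum>a<d. z a i * y a j) * (\<Sum>e<d. z e k * y e j)) =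
            (\<Sum>j<d. \<Sum>a<d. \<Sum>e<d. z a i * z e k * (y a j * y e j))"
          unfolding sum_product by (simp add: mult_ac)
        also have "\<dots> = (\<Sum>a<d. \<Sum>j<d. \<Sum>e<d. z a i * z e k * (y a j * y e j))"
          by (rule sum.swap)
        also have "\<dots> = (\<Sum>a<d. \<Sum>e<d. \<Sum>j<d. z a i * z e k * (y a j * y e j))"
          by (intro sum.cong refl sum.swap)
        finally show ?thesis by (simp add: sum_distrib_left)
      qed
      also have "\<dots> = (\<Sum>j<d. if j = i then of_bool (i = k) else 0)"
        using that by (intro sum.cong refl) (auto simp: z)
      finally show ?thesis using that by simp
    qed
    \<comment> \<open>The rows of \<open>L\<close> are orthonormal; as \<open>L\<close> is square,
      so are its columns, and this is what preserves lengths.\<close>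
    have orth': "(\<Sum>i<d. L i j * L i k) = of_bool (j = k)" if "j < d" "k < d" for j k
      using left_inverse_of_right_inverse[of d L "\<lambda>j k. L k j" j k] orth that by blast
    have "(\<Sum>i<d. (\<Sum>j<d. L i j * w j)\<^sup>2) = (\<Sum>i<d. \<Sum>j<d. \<Sum>k<d. w j * w k * (L i j * L i k))"
      unfolding power2_eq_square sum_product by (simp add: mult_ac)
    also have "\<dots> = (\<Sum>j<d. \<Sum>i<d. \<Sum>k<d. w j * w k * (L i j * L i k))"
      by (rule sum.swap)
    also have "\<dots> = (\<Sum>j<d. \<Sum>k<d. \<Sum>i<d. w j * w k * (L i j * L i k))"
      by (intro sum.cong refl sum.swap)
    also have "\<dots> = (\<Sum>j<d. \<Sum>k<d. if k = j then w j * w k else 0)"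
    proof (intro sum.cong refl)
      fix j k assume "j \<in> {..<d}" "k \<in> {..<d}"
      then show "(\<Sum>i<d. w j * w k * (L i j * L i k)) = (if k = j then w j * w k else 0)"
        by (simp add: orth' flip: sum_distrib_left)
    qed
    also have "\<dots> = (\<Sum>j<d. (w j)\<^sup>2)"
      by (simp add: power2_eq_square)
    finally show "(\<Sum>i<d. (\<Sum>j<d. L i j * w j)\<^sup>2) = (\<Sum>j<d. (w j)\<^sup>2)" .
  qed
qed

text \<open>With \<open>P\<close> and \<open>Y\<close> the difference vectors of a pair in
  \<open>p\<close> and \<open>y\<close>, the inner product of \<open>(P + Y) / 2\<close> and
  \<open>Y - P\<close> is half the difference of the squared lengths. So equal lengths are exactly a
  first-order condition at the midpoint, without error terms.\<close>

lemma congruent_on_of_midpoint: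
  assumes rigid: "inf_rigid d V E (\<lambda>v i. (p v i + y v i) / 2)"
    and edges: "\<And>u v. u \<in> V \<Longrightarrow> v \<in> V \<Longrightarrow> {u, v} \<in> E \<Longrightarrow> sqdist d (y u) (y v) = sqdist d (p u) (p v)"
  shows "congruent_on d V p y"
proof -
  let ?z = "\<lambda>v i. (p v i + y v i) / 2" and ?m = "\<lambda>v i. y v i - p v i"
  have half: "(\<Sum>i<d. (?z u i - ?z v i) * (?m u i - ?m v i)) =
      (sqdist d (y u) (y v) - sqdist d (p u) (p v)) / 2" for u v
    unfolding sqdist_def sum_subtractf[symmetric] sum_divide_distrib
    by (intro sum.cong refl) (simp add: power2_eq_square field_simps)
  have "edge_motion d V E ?z ?m"
    unfolding edge_motion_def half using edges by simp
  then have "trivial_motion d V ?z ?m"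
    using rigid unfolding inf_rigid_def by blast
  then have "(sqdist d (y u) (y v) - sqdist d (p u) (p v)) / 2 = 0" if "u \<in> V" "v \<in> V" for u v
    using trivial_motion_orthogonal[of d V ?z ?m u v] that half[of u v] by simp
  then show ?thesis
    unfolding congruent_on_def by simp
qed

lemma rigid_framework_if_inf_rigid:
  assumes "finite V" and rigid: "inf_rigid d V E p" and span: "spanning d V p"
  shows "rigid_framework d V E p"
  unfolding rigid_framework_def edist_eq_iff_sqdist
proof (intro allI impI)
  fix q
  assume q: "continuous_motion d V p q \<and> (\<forall>t\<in>{0..1}. \<forall>u\<in>V. \<forall>v\<in>V. {u, v} \<in> E \<longrightarrow>
    sqdist d (q t u) (q t v) = sqdist d (p u) (p v))"
  have cont: "continuous_on {0..1} (\<lambda>t. q t v i)" if "v \<in> V" "i < d" for v i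
    using q that unfolding continuous_motion_def by blast
  obtain \<epsilon> where "\<epsilon> > 0" and \<epsilon>: "\<And>y. (\<And>v i. v \<in> V \<Longrightarrow> i < d \<Longrightarrow> \<bar>y v i - p v i\<bar> < \<epsilon>) \<Longrightarrow> inf_rigid d V E y"
    using inf_rigid_open[OF assms(1) rigid] by blast
  let ?S = "{0..1::real}"
  \<comment> \<open>Congruence to \<open>p\<close> is locally constant in time. Near a time where it
    fails, continuity of one changed distance suffices; the other case uses rigidity.\<close>
  have step: "\<exists>T. openin (top_of_set ?S) T \<and> a \<in> T \<and>
      (\<forall>s\<in>T. \<forall>t\<in>T. congruent_on d V p (q s) \<longrightarrow> congruent_on d V p (q t))" if a: "a \<in> ?S" for a
  proof (cases "congruent_on d V p (q a)")
    case False
    then obtain u v where uv: "u \<in> V" "v \<in> V" "sqdist d (q a u) (q a v) \<noteq> sqdist d (p u) (p v)"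
      unfolding congruent_on_def by force
    let ?f = "\<lambda>t. sqdist d (q t u) (q t v)"
    have "continuous_on ?S ?f"
      unfolding sqdist_def by (intro continuous_intros cont uv) auto
    then have "openin (top_of_set ?S) (?S \<inter> ?f -` (- {sqdist d (p u) (p v)}))"
      by (rule continuous_openin_preimage_gen) auto
    moreover have "\<not> congruent_on d V p (q s)" if "s \<in> ?S \<inter> ?f -` (- {sqdist d (p u) (p v)})" for s
    proof
      assume "congruent_on d V p (q s)"
      then have "sqdist d (p u) (p v) = sqdist d (q s u) (q s v)"
        using uv unfolding congruent_on_def by blast
      then show False using that by simp
    qed
    ultimately show ?thesis
      using a uv by (intro exI[of _ "?S \<inter> ?f -` (- {sqdist d (p u) (p v)})"]) auto
  next
    case True
    then obtain L c where L: "\<And>v i. v \<in> V \<Longrightarrow> i < d \<Longrightarrow> p v i = (\<Sum>j<d. L i j * q a v j) + c i"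
      and iso: "\<And>w. (\<Sum>i<d. (\<Sum>j<d. L i j * w j)\<^sup>2) = (\<Sum>j<d. (w j)\<^sup>2)"
      using congruent_on_isometry[OF span] by blast
    \<comment> \<open>The isometry found at time \<open>a\<close> moves \<open>q a\<close> back onto
      \<open>p\<close>. Applied to every \<open>q t\<close> it keeps all distances, and the moved
      configuration is close to \<open>p\<close> for \<open>t\<close> near \<open>a\<close>, so the
      midpoint argument applies.\<close>
    define y where "y t v i = (\<Sum>j<d. L i j * q t v j) + c i" for t v i
    have sq: "sqdist d (y t u) (y t v) = sqdist d (q t u) (q t v)" for t u v
    proof -
      have "y t u i - y t v i = (\<Sum>j<d. L i j * (q t u j - q t v j))" for i
        by (simp add: y_def right_diff_distrib sum_subtractf)
      then show ?thesis
        unfolding sqdist_def using iso[of "\<lambda>j. q t u j - q t v j"] by presburger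
    qed
    let ?f = "\<lambda>t. \<Sum>v\<in>V. \<Sum>i<d. \<bar>y t v i - p v i\<bar>"
    have "continuous_on ?S ?f"
      unfolding y_def by (intro continuous_intros cont) auto
    then have op: "openin (top_of_set ?S) (?S \<inter> ?f -` {..<\<epsilon>})"
      by (rule continuous_openin_preimage_gen) auto
    have "?f a = 0"
      by (simp add: y_def L)
    then have mem: "a \<in> ?S \<inter> ?f -` {..<\<epsilon>}"
      using a \<open>\<epsilon> > 0\<close> by simp
    have "congruent_on d V p (q t)" if t: "t \<in> ?S \<inter> ?f -` {..<\<epsilon>}" for t
    proof -
      have near: "\<bar>y t v i - p v i\<bar> < \<epsilon>" if "v \<in> V" "i < d" for v i
      proof -
        have "\<bar>y t v i - p v i\<bar> \<le> (\<Sum>i<d. \<bar>y t v i - p v i\<bar>)"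
          using that by (intro member_le_sum) auto
        also have "\<dots> \<le> ?f t"
          using that \<open>finite V\<close> by (intro member_le_sum[of v V "\<lambda>v. \<Sum>i<d. \<bar>y t v i - p v i\<bar>"]) (auto intro: sum_nonneg)
        also have "\<dots> < \<epsilon>" using t by simp
        finally show ?thesis .
      qed
      have "inf_rigid d V E (\<lambda>v i. (p v i + y t v i) / 2)"
      proof (rule \<epsilon>)
        fix v i assume "v \<in> V" "i < d"
        then have "\<bar>y t v i - p v i\<bar> < \<epsilon>" by (rule near)
        moreover have "(p v i + y t v i) / 2 - p v i = (y t v i - p v i) / 2" by (simp add: field_simps)
        ultimately show "\<bar>(p v i + y t v i) / 2 - p v i\<bar> < \<epsilon>" by simp
      qed
      then have "congruent_on d V p (y t)"
        using q t by (intro congruent_on_of_midpoint) (auto simp: sq)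
      then show ?thesis
        unfolding congruent_on_def sq .
    qed
    then show ?thesis using op mem by blast
  qed
  have start: "congruent_on d V p (q 0)"
    using q unfolding congruent_on_def continuous_motion_def sqdist_def by simp
  have "congruent_on d V p (q t)" if "t \<in> ?S" for t
    by (rule connected_induction_simple[where S = ?S and a = 0 and b = t and P = "\<lambda>t. congruent_on d V p (q t)"])
      (use that start step in auto)
  then show "\<forall>t\<in>?S. \<forall>u\<in>V. \<forall>v\<in>V. sqdist d (q t u) (q t v) = sqdist d (p u) (p v)"
    unfolding congruent_on_def by simp
qed

subsection \<open>Density of generic configurations\<close>

lemma countable_monomials:
  assumes "finite I"
  shows "countable {m :: 'i \<Rightarrow>\<^sub>0 nat. Poly_Mapping.keys m \<subseteq> I}" (is "countable ?A")
proof (rule countable_image_inj_on)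
  show "inj_on (\<lambda>m. restrict (Poly_Mapping.lookup m) I) ?A"
  proof (rule inj_onI, rule poly_mapping_eqI)
    fix m m' :: "'i \<Rightarrow>\<^sub>0 nat" and i
    assume *: "m \<in> ?A" "m' \<in> ?A"
      "restrict (Poly_Mapping.lookup m) I = restrict (Poly_Mapping.lookup m') I"
    show "Poly_Mapping.lookup m i = Poly_Mapping.lookup m' i"
    proof (cases "i \<in> I")
      case True
      then show ?thesis using *(3) by (metis restrict_apply')
    next
      case False
      then have "i \<notin> Poly_Mapping.keys m" "i \<notin> Poly_Mapping.keys m'" using *(1,2) by auto
      then show ?thesis by (simp add: in_keys_iff)
    qed
  qed
  show "countable ((\<lambda>m. restrict (Poly_Mapping.lookup m) I) ` ?A)"
    by (rule countable_subset[of _ "I \<rightarrow>\<^sub>E (UNIV :: nat set)"]) (auto intro!: countable_PiE assms)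
qed

lemma countable_rat_mpolys:
  assumes "finite I"
  shows "countable {P :: ('i \<Rightarrow>\<^sub>0 nat) \<Rightarrow>\<^sub>0 rat. \<forall>m\<in>Poly_Mapping.keys P. Poly_Mapping.keys m \<subseteq> I}"
    (is "countable ?A")
proof (rule countable_image_inj_on)
  \<comment> \<open>A polynomial is determined by its finite set of monomial-coefficient pairs, and
    a countable set has only countably many finite subsets.\<close>
  let ?g = "\<lambda>P :: ('i \<Rightarrow>\<^sub>0 nat) \<Rightarrow>\<^sub>0 rat. (\<lambda>m. (m, Poly_Mapping.lookup P m)) ` Poly_Mapping.keys P"
  show "inj_on ?g ?A"
  proof (rule inj_onI, rule poly_mapping_eqI)
    fix P Q :: "('i \<Rightarrow>\<^sub>0 nat) \<Rightarrow>\<^sub>0 rat" and m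
    assume eq: "?g P = ?g Q"
    have mem: "(m, c) \<in> ?g R \<longleftrightarrow> Poly_Mapping.lookup R m \<noteq> 0 \<and> c = Poly_Mapping.lookup R m"
      for R :: "('i \<Rightarrow>\<^sub>0 nat) \<Rightarrow>\<^sub>0 rat" and c
      by (auto simp: in_keys_iff)
    show "Poly_Mapping.lookup P m = Poly_Mapping.lookup Q m"
      using mem[of _ P] mem[of _ Q] unfolding eq by metis
  qed
  have "countable {m :: 'i \<Rightarrow>\<^sub>0 nat. Poly_Mapping.keys m \<subseteq> I}"
    by (rule countable_monomials[OF assms])
  then have "countable ({m :: 'i \<Rightarrow>\<^sub>0 nat. Poly_Mapping.keys m \<subseteq> I} \<times> (UNIV :: rat set))"
    by simp
  from countable_Collect_finite_subset[OF this] show "countable (?g ` ?A)"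
    by (rule countable_subset[rotated]) auto
qed

text \<open>Regard \<open>P\<close> as a polynomial in the variable \<open>i\<close>: its leading coefficient does not vanish at \<open>x\<close>.\<close>

lemma finite_roots_in_new_variable:
  fixes P :: "('i \<Rightarrow>\<^sub>0 nat) \<Rightarrow>\<^sub>0 rat"
  assumes indep: "alg_independent_over_rat J x" and "i \<notin> J" and "P \<noteq> 0"
    and keys: "\<And>m. m \<in> Poly_Mapping.keys P \<Longrightarrow> Poly_Mapping.keys m \<subseteq> insert i J"
  shows "finite {z. rat_mpoly_eval (x(i := z)) P = 0}"
proof -
  let ?deg = "\<lambda>m. Poly_Mapping.lookup m i"
  define n where "n = Max (?deg ` Poly_Mapping.keys P)"
  have ne: "?deg ` Poly_Mapping.keys P \<noteq> {}" using \<open>P \<noteq> 0\<close> by simp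
  have le_n: "?deg m \<le> n" if "m \<in> Poly_Mapping.keys P" for m
    unfolding n_def using that by (intro Max_ge) auto
  define co where "co k = (\<Sum>m\<in>{m \<in> Poly_Mapping.keys P. ?deg m = k}.
      of_rat (Poly_Mapping.lookup P m) * (\<Prod>j\<in>Poly_Mapping.keys m - {i}. x j ^ Poly_Mapping.lookup m j))" for k
  have eval: "rat_mpoly_eval (x(i := z)) P = (\<Sum>k\<le>n. co k * z ^ k)" for z
  proof -
    have pow: "(\<Prod>j\<in>Poly_Mapping.keys m. (x(i := z)) j ^ Poly_Mapping.lookup m j) =
        (\<Prod>j\<in>Poly_Mapping.keys m - {i}. x j ^ Poly_Mapping.lookup m j) * z ^ ?deg m" for m
    proof -
      have "(\<Prod>j\<in>Poly_Mapping.keys m - {i}. (x(i := z)) j ^ Poly_Mapping.lookup m j) =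
          (\<Prod>j\<in>Poly_Mapping.keys m - {i}. x j ^ Poly_Mapping.lookup m j)"
        by (intro prod.cong) auto
      moreover have "?deg m = 0" if "i \<notin> Poly_Mapping.keys m"
        using that by (simp add: in_keys_iff)
      ultimately show ?thesis
        by (cases "i \<in> Poly_Mapping.keys m") (auto simp: prod.remove[of _ i])
    qed
    have "rat_mpoly_eval (x(i := z)) P = (\<Sum>m\<in>Poly_Mapping.keys P. of_rat (Poly_Mapping.lookup P m) *
        (\<Prod>j\<in>Poly_Mapping.keys m - {i}. x j ^ Poly_Mapping.lookup m j) * z ^ ?deg m)"
      unfolding rat_mpoly_eval_def pow by (simp add: mult.assoc)
    also have "\<dots> = (\<Sum>k\<le>n. \<Sum>m\<in>{m \<in> Poly_Mapping.keys P. ?deg m = k}. of_rat (Poly_Mapping.lookup P m) *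
        (\<Prod>j\<in>Poly_Mapping.keys m - {i}. x j ^ Poly_Mapping.lookup m j) * z ^ ?deg m)"
      using le_n by (intro sum.group[symmetric]) auto
    also have "\<dots> = (\<Sum>k\<le>n. co k * z ^ k)"
      unfolding co_def sum_distrib_right by (intro sum.cong refl) auto
    finally show ?thesis .
  qed
  \<comment> \<open>\<open>Q\<close> is the coefficient of the \<open>n\<close>-th power of variable
    \<open>i\<close>: its coefficient at \<open>m\<close> is that of \<open>P\<close> at
    \<open>m\<close> multiplied by that power. Maximality of \<open>n\<close> ensures that
    \<open>i\<close> does not occur in \<open>Q\<close>, so independence over \<open>J\<close>
    applies to it.\<close>
  let ?sh = "\<lambda>m. m + Poly_Mapping.single i n"
  define Q where "Q = Poly_Mapping.map_key ?sh P"
  have inj: "inj ?sh" by (auto intro: injI)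
  have lookupQ: "Poly_Mapping.lookup Q m = Poly_Mapping.lookup P (?sh m)" for m
    unfolding Q_def by (simp add: map_key.rep_eq[OF inj])
  have keysQ: "m \<in> Poly_Mapping.keys Q \<longleftrightarrow> ?sh m \<in> Poly_Mapping.keys P" for m
    by (simp add: in_keys_iff lookupQ)
  have degQ: "?deg m = 0" if "m \<in> Poly_Mapping.keys Q" for m
    using le_n[of "?sh m"] that by (simp add: keysQ lookup_add)
  have sh_keys: "Poly_Mapping.keys (?sh m) - {i} = Poly_Mapping.keys m" if "?deg m = 0" for m
    using that by (auto simp: in_keys_iff lookup_add lookup_single when_def split: if_splits)
  have image: "?sh ` Poly_Mapping.keys Q = {m \<in> Poly_Mapping.keys P. ?deg m = n}"
  proof (intro subset_antisym subsetI)
    fix m assume "m \<in> ?sh ` Poly_Mapping.keys Q"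
    then show "m \<in> {m \<in> Poly_Mapping.keys P. ?deg m = n}"
      using degQ by (auto simp: keysQ lookup_add)
  next
    fix m assume m: "m \<in> {m \<in> Poly_Mapping.keys P. ?deg m = n}"
    have "m = ?sh (m - Poly_Mapping.single i n)"
      using m by (intro poly_mapping_eqI) (auto simp: lookup_add lookup_minus lookup_single when_def)
    then show "m \<in> ?sh ` Poly_Mapping.keys Q"
      using m by (metis (no_types, lifting) keysQ imageI mem_Collect_eq)
  qed
  have "co n = rat_mpoly_eval x Q"
  proof -
    have "co n = (\<Sum>m\<in>Poly_Mapping.keys Q. of_rat (Poly_Mapping.lookup P (?sh m)) *
        (\<Prod>j\<in>Poly_Mapping.keys (?sh m) - {i}. x j ^ Poly_Mapping.lookup (?sh m) j))"
      unfolding co_def image[symmetric] by (subst sum.reindex) (auto intro: inj_on_subset[OF inj])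
    also have "\<dots> = rat_mpoly_eval x Q"
      unfolding rat_mpoly_eval_def
    proof (intro sum.cong refl arg_cong2[where f = "(*)"])
      fix m assume m: "m \<in> Poly_Mapping.keys Q"
      then have "i \<notin> Poly_Mapping.keys m" using degQ by (simp add: in_keys_iff)
      then show "(\<Prod>j\<in>Poly_Mapping.keys (?sh m) - {i}. x j ^ Poly_Mapping.lookup (?sh m) j) =
          (\<Prod>j\<in>Poly_Mapping.keys m. x j ^ Poly_Mapping.lookup m j)"
        unfolding sh_keys[OF degQ[OF m]] by (intro prod.cong) (auto simp: lookup_add lookup_single when_def)
    qed (simp add: lookupQ)
    finally show ?thesis .
  qed
  moreover have "rat_mpoly_eval x Q \<noteq> 0"
  proof
    assume "rat_mpoly_eval x Q = 0"
    moreover have "\<forall>m\<in>Poly_Mapping.keys Q. Poly_Mapping.keys m \<subseteq> J"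
    proof
      fix m assume m: "m \<in> Poly_Mapping.keys Q"
      have "Poly_Mapping.keys (?sh m) \<subseteq> insert i J"
        using m by (intro keys) (simp add: keysQ)
      then show "Poly_Mapping.keys m \<subseteq> J"
        unfolding sh_keys[OF degQ[OF m], symmetric] by blast
    qed
    ultimately have "Q = 0"
      using indep unfolding alg_independent_over_rat_def by blast
    moreover have "n \<in> ?deg ` Poly_Mapping.keys P"
      unfolding n_def using ne by (intro Max_in) auto
    ultimately show False
      using image by auto
  qed
  ultimately have "co n \<noteq> 0" by simp
  then show ?thesis
    unfolding eval using Transcendental.polyfun_rootbound[of co n n] by blast
qed

text \<open>Coordinates are chosen one at a time. Each of the countably many nonzero polynomials
  excludes finitely many values of the new coordinate, and an open interval is uncountable.\<close>

lemma alg_independent_dense: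
  fixes x0 :: "'i \<Rightarrow> real"
  assumes "finite I" "\<epsilon> > 0"
  shows "\<exists>x. alg_independent_over_rat I x \<and> (\<forall>i\<in>I. \<bar>x i - x0 i\<bar> < \<epsilon>)"
  using assms(1)
proof (induction I rule: finite_induct)
  case empty
  have "P = 0" if "\<forall>m\<in>Poly_Mapping.keys P. Poly_Mapping.keys m \<subseteq> {}" "rat_mpoly_eval x0 P = 0"
    for P :: "('i \<Rightarrow>\<^sub>0 nat) \<Rightarrow>\<^sub>0 rat"
  proof (rule ccontr)
    assume "P \<noteq> 0"
    then have "Poly_Mapping.keys P \<noteq> {}" by simp
    moreover have "m = 0" if "m \<in> Poly_Mapping.keys P" for m
      using that \<open>\<forall>m\<in>Poly_Mapping.keys P. Poly_Mapping.keys m \<subseteq> {}\<close> by auto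
    ultimately have "Poly_Mapping.keys P = {0}" by blast
    moreover from this have "Poly_Mapping.lookup P 0 \<noteq> 0" by (simp flip: in_keys_iff)
    ultimately show False using that(2) by (simp add: rat_mpoly_eval_def)
  qed
  then show ?case by (auto simp: alg_independent_over_rat_def)
next
  case (insert i J)
  then obtain x where x: "alg_independent_over_rat J x" "\<And>j. j \<in> J \<Longrightarrow> \<bar>x j - x0 j\<bar> < \<epsilon>"
    by blast
  let ?A = "{P :: ('i \<Rightarrow>\<^sub>0 nat) \<Rightarrow>\<^sub>0 rat. \<forall>m\<in>Poly_Mapping.keys P. Poly_Mapping.keys m \<subseteq> insert i J} - {0}"
  let ?B = "\<Union>P\<in>?A. {z. rat_mpoly_eval (x(i := z)) P = 0}"
  have "countable ?A"
    using countable_rat_mpolys[of "insert i J"] insert.hyps by (intro countable_Diff) simp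
  then have "countable ?B"
  proof (rule countable_UN)
    fix P assume "P \<in> ?A"
    then show "countable {z. rat_mpoly_eval (x(i := z)) P = 0}"
      by (intro countable_finite finite_roots_in_new_variable[OF x(1) insert.hyps(2)]) auto
  qed
  moreover have "uncountable {x0 i - \<epsilon><..<x0 i + \<epsilon>}"
    using \<open>\<epsilon> > 0\<close> by (simp add: uncountable_open_interval)
  ultimately obtain z where z: "z \<in> {x0 i - \<epsilon><..<x0 i + \<epsilon>}" "z \<notin> ?B"
    by (meson countable_subset subsetI)
  have "alg_independent_over_rat (insert i J) (x(i := z))"
    unfolding alg_independent_over_rat_def using z(2) by blast
  moreover have "\<bar>(x(i := z)) j - x0 j\<bar> < \<epsilon>" if "j \<in> insert i J" for j
    using that x(2)[of j] z(1) insert.hyps by (cases "j = i") (auto simp: abs_less_iff)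
  ultimately show ?case by blast
qed

lemma generic_dense:
  assumes "finite V" "\<epsilon> > 0"
  obtains y where "generic d V y" "\<And>v i. v \<in> V \<Longrightarrow> i < d \<Longrightarrow> \<bar>y v i - x v i\<bar> < \<epsilon>"
proof -
  obtain y where y: "alg_independent_over_rat (V \<times> {..<d}) y"
    "\<And>p. p \<in> V \<times> {..<d} \<Longrightarrow> \<bar>y p - x (fst p) (snd p)\<bar> < \<epsilon>"
    using alg_independent_dense[of "V \<times> {..<d}" \<epsilon> "\<lambda>p. x (fst p) (snd p)"] assms by auto
  have "generic d V (\<lambda>v i. y (v, i))"
    using y(1) by (simp add: generic_def)
  then show thesis
    using that[of "\<lambda>v i. y (v, i)"] y(2) by fastforce
qed

subsection \<open>Giant components between colour classes\<close>

text \<open>Components are described dually, by the functions constant along edges, instead of by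
  paths. This suits the application, where projections of a motion are such functions.\<close>

definition edge_constant :: "'a set set \<Rightarrow> 'a set \<Rightarrow> 'a set \<Rightarrow> ('a \<Rightarrow> real) set" where
  "edge_constant E X Y = {\<phi>. \<forall>x\<in>X. \<forall>y\<in>Y. {x, y} \<in> E \<longrightarrow> \<phi> x = \<phi> y}"

text \<open>This is the component relation of the bipartite graph between \<open>X\<close> and \<open>Y\<close>.\<close>

definition linked :: "'a set set \<Rightarrow> 'a set \<Rightarrow> 'a set \<Rightarrow> 'a \<Rightarrow> 'a \<Rightarrow> bool" where
  "linked E X Y u v \<longleftrightarrow> (\<forall>\<phi>\<in>edge_constant E X Y. \<phi> u = \<phi> v)"

definition small_component :: "'a set set \<Rightarrow> nat \<Rightarrow> 'a set \<Rightarrow> 'a set \<Rightarrow> 'a \<Rightarrow> bool" where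
  "small_component E h X Y u \<longleftrightarrow>
     card {x \<in> X. linked E X Y u x} < h \<and> card {y \<in> Y. linked E X Y u y} < h"

definition no_bihole :: "'a set set \<Rightarrow> nat \<Rightarrow> 'a set \<Rightarrow> 'a set \<Rightarrow> bool" where
  "no_bihole E h X Y \<longleftrightarrow>
     (\<forall>P Q. P \<subseteq> X \<longrightarrow> Q \<subseteq> Y \<longrightarrow> h \<le> card P \<longrightarrow> h \<le> card Q \<longrightarrow> (\<exists>x\<in>P. \<exists>y\<in>Q. {x, y} \<in> E))"

lemma linked_refl: "linked E X Y u u"
  by (simp add: linked_def)

lemma linked_cong: "linked E X Y u v \<Longrightarrow> linked E X Y u w \<longleftrightarrow> linked E X Y v w"
  unfolding linked_def by (rule ball_cong, rule refl, drule (1) bspec) simp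

lemma linked_sym: "linked E X Y u v \<Longrightarrow> linked E X Y v u"
  using linked_cong[of E X Y u v u] linked_refl[of E X Y u] by blast

lemma linked_edge: "x \<in> X \<Longrightarrow> y \<in> Y \<Longrightarrow> {x, y} \<in> E \<Longrightarrow> linked E X Y x y"
  by (simp add: linked_def edge_constant_def)

lemma linked_edge_iff:
  assumes "x \<in> X" "y \<in> Y" "{x, y} \<in> E"
  shows "linked E X Y u x \<longleftrightarrow> linked E X Y u y"
proof -
  have "linked E X Y x u \<longleftrightarrow> linked E X Y y u"
    by (rule linked_cong[OF linked_edge[OF assms]])
  then show ?thesis by (blast intro: linked_sym)
qed

lemma linked_mono:
  assumes "linked E X' Y' u v" "X' \<subseteq> X" "Y' \<subseteq> Y"
  shows "linked E X Y u v"
proof -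
  have "edge_constant E X Y \<subseteq> edge_constant E X' Y'"
    using assms(2,3) by (auto simp: edge_constant_def)
  then show ?thesis using assms(1) by (auto simp: linked_def)
qed

lemma small_component_antimono:
  assumes "small_component E h X Y u" "X' \<subseteq> X" "Y' \<subseteq> Y" "finite X" "finite Y"
  shows "small_component E h X' Y' u"
proof -
  have "card {x \<in> X'. linked E X' Y' u x} \<le> card {x \<in> X. linked E X Y u x}"
    using assms linked_mono[OF _ assms(2,3)] by (intro card_mono) auto
  moreover have "card {x \<in> Y'. linked E X' Y' u x} \<le> card {x \<in> Y. linked E X Y u x}"
    using assms linked_mono[OF _ assms(2,3)] by (intro card_mono) auto
  ultimately show ?thesis
    using assms(1) unfolding small_component_def by linarith
qed

lemma small_component_linked:
  assumes "small_component E h X Y u" "linked E X Y u v"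
  shows "small_component E h X Y v"
proof -
  have "linked E X Y v = linked E X Y u"
    using linked_cong[OF assms(2)] by blast
  then show ?thesis using assms(1) by (simp add: small_component_def)
qed

lemma no_bihole_commute: "no_bihole E h X Y \<Longrightarrow> no_bihole E h Y X"
  unfolding no_bihole_def by (subst insert_commute) blast

lemma no_bihole_subset: "no_bihole E h X Y \<Longrightarrow> X' \<subseteq> X \<Longrightarrow> Y' \<subseteq> Y \<Longrightarrow> no_bihole E h X' Y'"
  unfolding no_bihole_def by (meson order_trans)

text \<open>There is no edge between \<open>X \<inter> Z\<close> and \<open>Y - Z\<close>, so both
  cannot have \<open>h\<close> vertices.\<close>

lemma no_bihole_closed:
  assumes "no_bihole E h X Y" "h \<le> card (X \<inter> Z)"
    and "\<And>x y. x \<in> X \<Longrightarrow> y \<in> Y \<Longrightarrow> {x, y} \<in> E \<Longrightarrow> x \<in> Z \<Longrightarrow> y \<in> Z"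
  shows "card (Y - Z) < h"
proof (rule ccontr)
  assume "\<not> ?thesis"
  then obtain x y where "x \<in> X \<inter> Z" "y \<in> Y - Z" "{x, y} \<in> E"
    using assms(1)[unfolded no_bihole_def, rule_format, of "X \<inter> Z" "Y - Z"] assms(2) by auto
  then show False using assms(3) by blast
qed

text \<open>Small components are united one at a time. If both parts of the union are below
  \<open>h\<close>, adding one more keeps them below \<open>2 * h\<close>. Had one part reached
  \<open>h\<close>, the union would miss fewer than \<open>h\<close> vertices of the other side,
  which is impossible as that side has at least \<open>3 * h\<close>.\<close>

lemma few_in_small_components:
  assumes "finite X" "finite Y" "0 < h" "3 * h \<le> card X" "3 * h \<le> card Y" "no_bihole E h X Y"
  shows "card {x \<in> X. small_component E h X Y x} < h \<and> card {y \<in> Y. small_component E h X Y y} < h"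
proof -
  define U where "U F = {v. \<exists>u\<in>F. linked E X Y u v}" for F
  have union: "card (X \<inter> U F) < h \<and> card (Y \<inter> U F) < h"
    if "finite F" "\<And>u. u \<in> F \<Longrightarrow> small_component E h X Y u" for F
    using that
  proof (induction F rule: finite_induct)
    case empty
    then show ?case using \<open>0 < h\<close> by (simp add: U_def)
  next
    case (insert u F)
    let ?Z = "U (insert u F)"
    have IH: "card (X \<inter> U F) < h" "card (Y \<inter> U F) < h" using insert by auto
    have small: "card {x \<in> X. linked E X Y u x} < h" "card {y \<in> Y. linked E X Y u y} < h"
      using insert.prems[of u] by (auto simp: small_component_def)
    have "X \<inter> ?Z = {x \<in> X. linked E X Y u x} \<union> (X \<inter> U F)" "Y \<inter> ?Z = {y \<in> Y. linked E X Y u y} \<union> (Y \<inter> U F)"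
      by (auto simp: U_def)
    then have two: "card (X \<inter> ?Z) < 2 * h" "card (Y \<inter> ?Z) < 2 * h"
      using small IH card_Un_le[of "{x \<in> X. linked E X Y u x}" "X \<inter> U F"]
        card_Un_le[of "{y \<in> Y. linked E X Y u y}" "Y \<inter> U F"] by simp_all
    have split: "card X = card (X \<inter> ?Z) + card (X - ?Z)" "card Y = card (Y \<inter> ?Z) + card (Y - ?Z)"
      by (rule card_Int_Diff[OF assms(1)], rule card_Int_Diff[OF assms(2)])
    have closed: "x \<in> ?Z \<longleftrightarrow> y \<in> ?Z" if "x \<in> X" "y \<in> Y" "{x, y} \<in> E" for x y
      using linked_edge_iff[OF that] unfolding U_def by blast
    have "\<not> h \<le> card (X \<inter> ?Z)"
    proof
      assume "h \<le> card (X \<inter> ?Z)"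
      then have "card (Y - ?Z) < h"
        using closed by (intro no_bihole_closed[OF assms(6)]) auto
      then show False using split(2) two(2) assms(5) by linarith
    qed
    moreover have "\<not> h \<le> card (Y \<inter> ?Z)"
    proof
      assume "h \<le> card (Y \<inter> ?Z)"
      then have "card (X - ?Z) < h"
        using closed by (intro no_bihole_closed[OF no_bihole_commute[OF assms(6)]]) (auto simp: insert_commute)
      then show False using split(1) two(1) assms(4) by linarith
    qed
    ultimately show ?case by simp
  qed
  define F where "F = {u \<in> X \<union> Y. small_component E h X Y u}"
  have "card (X \<inter> U F) < h \<and> card (Y \<inter> U F) < h"
    using assms(1,2) by (intro union) (auto simp: F_def)
  moreover have "card {x \<in> X. small_component E h X Y x} \<le> card (X \<inter> U F)"
    using assms(1) by (intro card_mono) (auto simp: U_def F_def intro: linked_refl)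
  moreover have "card {y \<in> Y. small_component E h X Y y} \<le> card (Y \<inter> U F)"
    using assms(2) by (intro card_mono) (auto simp: U_def F_def intro: linked_refl)
  ultimately show ?thesis by linarith
qed

text \<open>A component that is not small misses fewer than \<open>h\<close> vertices of
  \<open>X\<close>. As \<open>X\<close> has at least \<open>3 * h\<close> vertices, two such
  components meet.\<close>

lemma large_components_linked:
  assumes "finite X" "finite Y" "0 < h" "3 * h \<le> card X" "3 * h \<le> card Y" "no_bihole E h X Y"
    and "\<not> small_component E h X Y u" "\<not> small_component E h X Y v"
  shows "linked E X Y u v"
proof -
  have miss: "card (X - {w. linked E X Y u w}) < h" if "\<not> small_component E h X Y u" for u
  proof -
    let ?Z = "{w. linked E X Y u w}"
    have eq: "X \<inter> ?Z = {x \<in> X. linked E X Y u x}" "Y \<inter> ?Z = {y \<in> Y. linked E X Y u y}" by auto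
    have closed: "x \<in> ?Z \<longleftrightarrow> y \<in> ?Z" if "x \<in> X" "y \<in> Y" "{x, y} \<in> E" for x y
      using linked_edge_iff[OF that] by blast
    have "h \<le> card (Y \<inter> ?Z)"
    proof (rule ccontr)
      assume less: "\<not> h \<le> card (Y \<inter> ?Z)"
      then have "h \<le> card (X \<inter> ?Z)"
        using that unfolding small_component_def eq by linarith
      then have "card (Y - ?Z) < h"
        using closed by (intro no_bihole_closed[OF assms(6)]) auto
      then show False
        using card_Int_Diff[OF assms(2), of ?Z] less assms(5) by linarith
    qed
    then show ?thesis
      using closed by (intro no_bihole_closed[OF no_bihole_commute[OF assms(6)]]) (auto simp: insert_commute)
  qed
  have "\<not> X \<subseteq> (X - {w. linked E X Y u w}) \<union> (X - {w. linked E X Y v w})"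
  proof
    assume "X \<subseteq> (X - {w. linked E X Y u w}) \<union> (X - {w. linked E X Y v w})"
    then have "card X \<le> card ((X - {w. linked E X Y u w}) \<union> (X - {w. linked E X Y v w}))"
      using assms(1) by (intro card_mono) auto
    also have "\<dots> \<le> card (X - {w. linked E X Y u w}) + card (X - {w. linked E X Y v w})"
      by (rule card_Un_le)
    finally show False
      using miss[OF assms(7)] miss[OF assms(8)] assms(3,4) by linarith
  qed
  then obtain w where "linked E X Y u w" "linked E X Y v w" by blast
  then show ?thesis using linked_cong[of E X Y w u v] by (blast intro: linked_sym)
qed

abbreviation colour_class :: "('a \<Rightarrow> nat) \<Rightarrow> 'a set \<Rightarrow> nat \<Rightarrow> 'a set" where
  "colour_class cl R a \<equiv> {v \<in> R. cl v = a}"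

text \<open>Vertices outside too many giant components are deleted one at a time. For each pair of colours
  \<open>a\<close>, \<open>b\<close>, the deleted vertices of colour \<open>a\<close> that were outside the giant component towards \<open>b\<close> remain
  nonadjacent to the current giant component, so there are fewer than \<open>h\<close> of them.\<close>

lemma peel:
  fixes cl :: "'a \<Rightarrow> nat"
  assumes "finite V" "0 < h"
    and cl: "\<And>v. v \<in> V \<Longrightarrow> cl v < M"
    and hole: "\<And>a b. a < M \<Longrightarrow> b < M \<Longrightarrow> a \<noteq> b \<Longrightarrow> no_bihole E h (colour_class cl V a) (colour_class cl V b)"
    and size: "\<And>a r. a < M \<Longrightarrow> Suc g * r \<le> (M - 1) * (h - 1) \<Longrightarrow> r + 3 * h + 1 \<le> card (colour_class cl V a)"
  obtains R where "R \<subseteq> V" "\<And>a. a < M \<Longrightarrow> 3 * h \<le> card (colour_class cl R a)"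
    "\<And>v. v \<in> R \<Longrightarrow>
      card {b. b < M \<and> b \<noteq> cl v \<and> small_component E h (colour_class cl R (cl v)) (colour_class cl R b) v} \<le> g"
proof -
  let ?small = "\<lambda>R a b u. small_component E h (colour_class cl R a) (colour_class cl R b) u"
  \<comment> \<open>\<open>bad v\<close> is the set of colours towards which \<open>v\<close> was in
    a small component when deleted. The last clause confines the surviving neighbours of
    \<open>v\<close> in those colours to small components; it persists because shrinking
    \<open>R\<close> keeps small components small.\<close>
  define Inv where "Inv R bad \<longleftrightarrow> R \<subseteq> V \<and>
      (\<forall>v\<in>V - R. bad v \<subseteq> {..<M} - {cl v} \<and> Suc g \<le> card (bad v)) \<and>
      (\<forall>v\<in>V - R. \<forall>b\<in>bad v. \<forall>u\<in>colour_class cl R b. {v, u} \<in> E \<longrightarrow> ?small R (cl v) b u)" for R bad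
  define cnt where "cnt R \<longleftrightarrow> (\<forall>a<M. Suc g * card (colour_class cl (V - R) a) \<le> (M - 1) * (h - 1))" for R
  have class_size: "card (colour_class cl V a) = card (colour_class cl R a) + card (colour_class cl (V - R) a)"
    if "R \<subseteq> V" for R a
  proof -
    have "colour_class cl V a = colour_class cl R a \<union> colour_class cl (V - R) a" using that by auto
    moreover have "finite R" using that \<open>finite V\<close> finite_subset by blast
    ultimately show ?thesis using \<open>finite V\<close> by (simp add: card_Un_disjoint disjoint_iff)
  qed
  \<comment> \<open>Double counting of pairs of a deleted vertex \<open>v\<close> of colour
    \<open>a\<close> and a colour in \<open>bad v\<close>: each vertex contributes at least
    \<open>Suc g\<close> pairs, each of the \<open>M - 1\<close> colours at most
    \<open>h - 1\<close>.\<close>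
  have count: "cnt R" if inv: "Inv R bad" and big: "\<And>a. a < M \<Longrightarrow> 3 * h \<le> card (colour_class cl R a)" for R bad
    unfolding cnt_def
  proof (intro allI impI)
    fix a assume a: "a < M"
    have R: "R \<subseteq> V" "finite R" using inv \<open>finite V\<close> finite_subset unfolding Inv_def by blast+
    have few: "card {v \<in> colour_class cl (V - R) a. b \<in> bad v} \<le> h - 1" if b: "b \<in> {..<M} - {a}" for b
    proof -
      let ?D = "{v \<in> colour_class cl (V - R) a. b \<in> bad v}"
      let ?T = "{u \<in> colour_class cl R b. \<not> ?small R a b u}"
      have "no_bihole E h (colour_class cl R a) (colour_class cl R b)"
        using R(1) a b by (intro no_bihole_subset[OF hole[of a b]]) auto
      then have "card {u \<in> colour_class cl R b. ?small R a b u} < h"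
        using few_in_small_components[of "colour_class cl R a" "colour_class cl R b" h E] R(2) a b big \<open>0 < h\<close>
        by simp
      moreover have "card (colour_class cl R b) = card {u \<in> colour_class cl R b. ?small R a b u} + card ?T"
        using R(2) card_Int_Diff[of "colour_class cl R b" "{u. ?small R a b u}"]
        by (simp add: Int_def set_diff_eq)
      ultimately have "h \<le> card ?T" using big[of b] b by simp
      moreover have "\<not> (\<exists>x\<in>?D. \<exists>y\<in>?T. {x, y} \<in> E)"
        using inv unfolding Inv_def by auto
      moreover have "no_bihole E h (colour_class cl V a) (colour_class cl V b)"
        using hole a b by auto
      moreover have "?D \<subseteq> colour_class cl V a" "?T \<subseteq> colour_class cl V b"
        using R(1) by auto
      ultimately have "\<not> h \<le> card ?D"
        unfolding no_bihole_def by blast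
      then show ?thesis by simp
    qed
    have "Suc g * card (colour_class cl (V - R) a) = (\<Sum>v\<in>colour_class cl (V - R) a. Suc g)" by simp
    also have "\<dots> \<le> (\<Sum>v\<in>colour_class cl (V - R) a. card {b \<in> {..<M} - {a}. b \<in> bad v})"
    proof (rule sum_mono)
      fix v assume "v \<in> colour_class cl (V - R) a"
      then have "bad v \<subseteq> {..<M} - {a}" "Suc g \<le> card (bad v)" using inv unfolding Inv_def by auto
      moreover from this have "{b \<in> {..<M} - {a}. b \<in> bad v} = bad v" by auto
      ultimately show "Suc g \<le> card {b \<in> {..<M} - {a}. b \<in> bad v}" by simp
    qed
    also have "\<dots> = (\<Sum>b\<in>{..<M} - {a}. card {v \<in> colour_class cl (V - R) a. b \<in> bad v})"
      using sum.swap_restrict[of "colour_class cl (V - R) a" "{..<M} - {a}" "\<lambda>_ _. 1::nat" "\<lambda>v b. b \<in> bad v"] \<open>finite V\<close>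
      by simp
    also have "\<dots> \<le> (\<Sum>b\<in>{..<M} - {a}. h - 1)"
      by (intro sum_mono few)
    also have "\<dots> = (M - 1) * (h - 1)" using a by simp
    finally show "Suc g * card (colour_class cl (V - R) a) \<le> (M - 1) * (h - 1)" .
  qed
  \<comment> \<open>Deletion starts from \<open>V\<close>, where nothing has to be recorded. A
    smallest admissible \<open>R\<close> is one where the process has stopped.\<close>
  have "\<exists>R. (\<exists>bad. Inv R bad) \<and> cnt R"
    by (intro exI[of _ V]) (auto simp: Inv_def cnt_def)
  then obtain R where R0: "(\<exists>bad. Inv R bad) \<and> cnt R"
    and minimal: "\<And>R'. (\<exists>bad. Inv R' bad) \<and> cnt R' \<Longrightarrow> card R \<le> card R'"
    using ex_has_least_nat[of "\<lambda>R. (\<exists>bad. Inv R bad) \<and> cnt R" _ card]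
    by blast
  then obtain bad where inv: "Inv R bad" and cnt: "cnt R" by blast
  have R: "R \<subseteq> V" "finite R" using inv \<open>finite V\<close> finite_subset unfolding Inv_def by blast+
  \<comment> \<open>The extra 1 leaves room for one further deletion, after which
    \<open>count\<close> still finds classes of size \<open>3 * h\<close>.\<close>
  have big: "3 * h + 1 \<le> card (colour_class cl R a)" if "a < M" for a
    using size[OF that] cnt that class_size[OF R(1), of a] unfolding cnt_def by fastforce
  show thesis
  proof (rule that)
    show "R \<subseteq> V" by (rule R)
    show "3 * h \<le> card (colour_class cl R a)" if "a < M" for a
      using big[OF that] by simp
    show "card {b. b < M \<and> b \<noteq> cl v \<and> ?small R (cl v) b v} \<le> g" if v: "v \<in> R" for v
    proof (rule ccontr)
      assume many: "\<not> ?thesis"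
      define B where "B = {b. b < M \<and> b \<noteq> cl v \<and> ?small R (cl v) b v}"
      let ?R = "R - {v}"
      have small_R': "?small ?R a b u" if "?small R a b u" for a b u
        by (rule small_component_antimono[OF that]) (use R(2) in auto)
      have "Inv ?R (bad(v := B))"
        unfolding Inv_def
      proof (intro conjI ballI impI)
        show "?R \<subseteq> V" using R by auto
        fix w assume w: "w \<in> V - ?R"
        show "(bad(v := B)) w \<subseteq> {..<M} - {cl w}" "Suc g \<le> card ((bad(v := B)) w)"
          using w inv many unfolding Inv_def B_def by (auto simp: not_le)
        fix b u assume b: "b \<in> (bad(v := B)) w" and u: "u \<in> colour_class cl ?R b" and e: "{w, u} \<in> E"
        show "?small ?R (cl w) b u"
        proof (cases "w = v")
          \<comment> \<open>A neighbour of the vertex just deleted shares its component, which is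
            small.\<close>
          case True
          then have "?small R (cl v) b v" using b by (simp add: B_def)
          moreover have "linked E (colour_class cl R (cl v)) (colour_class cl R b) v u"
            using u e v True by (intro linked_edge) auto
          ultimately have "?small R (cl v) b u" by (rule small_component_linked)
          then show ?thesis using True small_R' by blast
        next
          case False
          then have "?small R (cl w) b u" using w b u e inv unfolding Inv_def by auto
          then show ?thesis by (rule small_R')
        qed
      qed
      moreover from this have "cnt ?R"
      proof (rule count)
        fix a assume "a < M"
        have "card (colour_class cl R a) \<le> Suc (card (colour_class cl R a - {v}))"
          using R(2) card_Suc_Diff1[of "colour_class cl R a" v] by (cases "v \<in> colour_class cl R a") auto
        moreover have "colour_class cl R a - {v} = colour_class cl ?R a" by auto
        ultimately show "3 * h \<le> card (colour_class cl ?R a)"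
          using big[OF \<open>a < M\<close>] by simp
      qed
      ultimately have "card R \<le> card ?R" by (intro minimal) blast
      moreover have "card ?R < card R" using v R(2) by (intro psubset_card_mono) auto
      ultimately show False by simp
    qed
  qed
qed

subsection \<open>The rigid core\<close>

text \<open>The polynomial with coefficients \<open>w k\<close> at degree \<open>k + 1\<close>,
  minus its value at \<open>a\<close>, has degree at most \<open>d\<close> but vanishes at
  \<open>a\<close> and on \<open>B\<close>, that is at more than \<open>d\<close> points.
  \<open>c\<close> lists its coefficients.\<close>

lemma moment_curve_general_position:
  fixes w :: "nat \<Rightarrow> real"
  assumes "finite B" "a \<notin> B" "d \<le> card B"
    and orth: "\<And>b. b \<in> B \<Longrightarrow> (\<Sum>i<d. (real a ^ Suc i - real b ^ Suc i) * w i) = 0"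
    and "i < d"
  shows "w i = 0"
proof (rule ccontr)
  assume "w i \<noteq> 0"
  define c where "c k = (case k of 0 \<Rightarrow> - (\<Sum>i<d. w i * real a ^ Suc i) | Suc k \<Rightarrow> w k)" for k
  have eval: "(\<Sum>k\<le>d. c k * z ^ k) = (\<Sum>k<d. w k * z ^ Suc k) - (\<Sum>k<d. w k * real a ^ Suc k)" for z
    unfolding sum.atMost_shift by (simp add: c_def)
  have "c (Suc i) \<noteq> 0" "Suc i \<le> d"
    using \<open>w i \<noteq> 0\<close> \<open>i < d\<close> by (simp_all add: c_def)
  then have "finite {z. (\<Sum>k\<le>d. c k * z ^ k) = 0} \<and> card {z. (\<Sum>k\<le>d. c k * z ^ k) = 0} \<le> d"
    by (rule Transcendental.polyfun_rootbound)
  moreover have "real ` insert a B \<subseteq> {z. (\<Sum>k\<le>d. c k * z ^ k) = 0}"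
  proof -
    have "(\<Sum>k<d. w k * real b ^ Suc k) = (\<Sum>k<d. w k * real a ^ Suc k)" if "b \<in> B" for b
      using orth[OF that] unfolding left_diff_distrib sum_subtractf mult.commute[of "w _"] by simp
    then show ?thesis unfolding eval by auto
  qed
  moreover have "card (real ` insert a B) = Suc (card B)"
  proof -
    have "card (real ` insert a B) = card (insert a B)"
      by (intro card_image inj_on_of_nat)
    then show ?thesis using assms(1,2) by simp
  qed
  ultimately show False
    using card_mono[of "{z. (\<Sum>k\<le>d. c k * z ^ k) = 0}" "real ` insert a B"] assms(3) by linarith
qed

text \<open>The first \<open>d + 1\<close> points determine the skew matrix and the translation. At
  any other point, general position forces agreement.\<close>

lemma complete_framework_trivial_motion:
  fixes q m :: "nat \<Rightarrow> nat \<Rightarrow> real"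
  assumes "d < M"
    and motion: "\<And>a b. a < M \<Longrightarrow> b < M \<Longrightarrow> (\<Sum>i<d. (q a i - q b i) * (m a i - m b i)) = 0"
    and gp: "\<And>a B w i. a < M \<Longrightarrow> B \<subseteq> {..<M} - {a} \<Longrightarrow> d \<le> card B \<Longrightarrow>
      (\<And>b. b \<in> B \<Longrightarrow> (\<Sum>i<d. (q a i - q b i) * w i) = 0) \<Longrightarrow> i < d \<Longrightarrow> w i = (0 :: real)"
  shows "\<exists>A c. (\<forall>i j. A i j = - A j i) \<and> (\<forall>a<M. \<forall>i<d. m a i = (\<Sum>j<d. A i j * q a j) + c i)"
proof -
  define x n where "x k i = q (Suc k) i - q 0 i" and "n k i = m (Suc k) i - m 0 i" for k i
  have inj: "injective_system {..<d} {..<d} x"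
    unfolding injective_system_def
  proof (intro allI impI ballI)
    fix w i assume w: "\<forall>e\<in>{..<d}. (\<Sum>i<d. x e i * w i) = 0" and i: "i \<in> {..<d}"
    show "w i = 0"
    proof (rule gp[of 0 "Suc ` {..<d}" w])
      fix b assume "b \<in> Suc ` {..<d}"
      then obtain e where "b = Suc e" "e < d" by auto
      then have "(\<Sum>i<d. x e i * w i) = 0" using w by simp
      then show "(\<Sum>i<d. (q 0 i - q b i) * w i) = 0"
        using \<open>b = Suc e\<close> by (simp add: x_def left_diff_distrib sum_subtractf)
    qed (use \<open>d < M\<close> i in \<open>auto simp: card_image\<close>)
  qed
  then obtain z where z: "\<And>i l. i < d \<Longrightarrow> l < d \<Longrightarrow> (\<Sum>k<d. z k i * x k l) = of_bool (i = l)"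
    using expand_in_spanning_family by blast
  have z': "(\<Sum>j<d. x e j * z k j) = of_bool (e = k)" if "e < d" "k < d" for e k
    using left_inverse_of_right_inverse[of d "\<lambda>i k. z k i" x e k] z that by blast
  \<comment> \<open>Inner products of positions and velocities relative to point 0. The pairs
    containing 0 make the diagonal vanish, and the remaining pairs then give skew symmetry.\<close>
  define G where "G l k = (if l < d \<and> k < d then (\<Sum>i<d. x l i * n k i) else 0)" for l k
  have G: "G l k = - G k l" for l k
  proof (cases "l < d \<and> k < d")
    case True
    have 1: "(\<Sum>i<d. x l i * n l i) = 0" if "l < d" for l
      using motion[of "Suc l" 0] that \<open>d < M\<close> by (simp add: x_def n_def)
    have "(\<Sum>i<d. (x l i - x k i) * (n l i - n k i)) = 0"
      using motion[of "Suc l" "Suc k"] True \<open>d < M\<close> by (simp add: x_def n_def)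
    also have "(\<Sum>i<d. (x l i - x k i) * (n l i - n k i)) =
        (\<Sum>i<d. x l i * n l i) + (\<Sum>i<d. x k i * n k i) - (\<Sum>i<d. x l i * n k i) - (\<Sum>i<d. x k i * n l i)"
      unfolding sum.distrib[symmetric] sum_subtractf[symmetric] by (intro sum.cong) (auto simp: algebra_simps)
    finally show ?thesis using True 1 by (simp add: G_def)
  qed (auto simp: G_def)
  \<comment> \<open>Since \<open>z\<close> is dual to \<open>x\<close>, this is the matrix that
    sends each \<open>x e\<close> to \<open>n e\<close>, and it inherits skew symmetry from
    \<open>G\<close>.\<close>
  define A where "A i j = (\<Sum>k<d. \<Sum>l<d. z l i * G l k * z k j)" for i j
  have skew: "A i j = - A j i" for i j
  proof -
    have "A j i = (\<Sum>l<d. \<Sum>k<d. z l j * G l k * z k i)"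
      unfolding A_def by (rule sum.swap)
    also have "\<dots> = (\<Sum>l<d. \<Sum>k<d. - (z k i * G k l * z l j))"
    proof (intro sum.cong refl)
      fix l k show "z l j * G l k * z k i = - (z k i * G k l * z l j)"
        using G[of l k] by simp
    qed
    also have "\<dots> = - A i j" by (simp add: A_def sum_negf)
    finally show ?thesis by simp
  qed
  have An: "(\<Sum>j<d. A i j * x e j) = n e i" if "i < d" "e < d" for i e
  proof -
    have "(\<Sum>j<d. A i j * x e j) = (\<Sum>j<d. \<Sum>k<d. (\<Sum>l<d. z l i * G l k) * (x e j * z k j))"
      unfolding A_def sum_distrib_right by (intro sum.cong refl) (simp add: mult_ac)
    also have "\<dots> = (\<Sum>k<d. (\<Sum>l<d. z l i * G l k) * (\<Sum>j<d. x e j * z k j))"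
      by (subst sum.swap) (simp add: sum_distrib_left)
    also have "\<dots> = (\<Sum>k<d. if k = e then (\<Sum>l<d. z l i * G l k) else 0)"
      using that by (intro sum.cong refl) (auto simp: z')
    also have "\<dots> = (\<Sum>l<d. z l i * (\<Sum>i'<d. x l i' * n e i'))"
      using that by (simp add: G_def)
    also have "\<dots> = (\<Sum>i'<d. (\<Sum>l<d. z l i * x l i') * n e i')"
      unfolding sum_distrib_left sum_distrib_right by (subst sum.swap) (simp add: mult.assoc)
    also have "\<dots> = (\<Sum>i'<d. if i' = i then n e i' else 0)"
      using that by (intro sum.cong refl) (auto simp: z)
    finally show ?thesis using that by simp
  qed
  define c where "c i = m 0 i - (\<Sum>j<d. A i j * q 0 j)" for i
  have base: "m b i = (\<Sum>j<d. A i j * q b j) + c i" if "b \<le> d" "i < d" for b i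
  proof (cases b)
    case 0
    then show ?thesis by (simp add: c_def)
  next
    case (Suc e)
    then have "(\<Sum>j<d. A i j * (q b j - q 0 j)) = m b i - m 0 i"
      using An[of i e] that by (simp add: x_def n_def)
    then show ?thesis by (simp add: c_def right_diff_distrib sum_subtractf)
  qed
  have "m a i = (\<Sum>j<d. A i j * q a j) + c i" if a: "a < M" and i: "i < d" for a i
  proof (cases "a \<le> d")
    case True
    then show ?thesis using base i by blast
  next
    case False
    \<comment> \<open>The deviation from the trivial motion at \<open>a\<close> is orthogonal to the
      \<open>d + 1\<close> directions towards the base points, hence zero.\<close>
    define w where "w i = m a i - ((\<Sum>j<d. A i j * q a j) + c i)" for i
    have "w i = 0"
    proof (rule gp[of a "{..d}" w])
      fix b assume b: "b \<in> {..d}"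
      have "(\<Sum>i<d. (q a i - q b i) * w i) = (\<Sum>i<d. (q a i - q b i) * (m a i - m b i))
          - (\<Sum>i<d. (q a i - q b i) * (\<Sum>j<d. A i j * (q a j - q b j)))"
        unfolding sum_subtractf[symmetric]
      proof (intro sum.cong refl)
        fix i assume "i \<in> {..<d}"
        then have "m b i = (\<Sum>j<d. A i j * q b j) + c i" using base b by simp
        moreover have "(\<Sum>j<d. A i j * (q a j - q b j)) = (\<Sum>j<d. A i j * q a j) - (\<Sum>j<d. A i j * q b j)"
          by (simp add: right_diff_distrib sum_subtractf)
        ultimately have "w i = (m a i - m b i) - (\<Sum>j<d. A i j * (q a j - q b j))"
          by (simp add: w_def)
        then show "(q a i - q b i) * w i = (q a i - q b i) * (m a i - m b i)
            - (q a i - q b i) * (\<Sum>j<d. A i j * (q a j - q b j))"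
          by (simp only: right_diff_distrib)
      qed
      also have "\<dots> = 0"
        using motion[of a b] skew_form_zero[OF skew, where w = "\<lambda>i. q a i - q b i" and d = d] a b \<open>d < M\<close> by simp
      finally show "(\<Sum>i<d. (q a i - q b i) * w i) = 0" .
    qed (use a i False in auto)
    then show ?thesis by (simp add: w_def)
  qed
  then show ?thesis using skew by blast
qed

text \<open>Each colour class sits at a single point of the moment curve, so the edges between two classes
  \<open>a\<close> and \<open>b\<close> force the component of a motion along \<open>q a - q b\<close> to be constant on the giant component.\<close>

lemma inf_rigid_moment_curve:
  fixes cl :: "'a \<Rightarrow> nat"
  assumes "finite R" "0 < h" "2 * g + d < M"
    and cl: "\<And>v. v \<in> R \<Longrightarrow> cl v < M"
    and size: "\<And>a. a < M \<Longrightarrow> 3 * h \<le> card (colour_class cl R a)"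
    and hole: "\<And>a b. a < M \<Longrightarrow> b < M \<Longrightarrow> a \<noteq> b \<Longrightarrow> no_bihole E h (colour_class cl R a) (colour_class cl R b)"
    and few: "\<And>v. v \<in> R \<Longrightarrow>
      card {b. b < M \<and> b \<noteq> cl v \<and> small_component E h (colour_class cl R (cl v)) (colour_class cl R b) v} \<le> g"
  shows "inf_rigid d R E (\<lambda>v i. real (cl v) ^ Suc i)" "spanning d R (\<lambda>v i. real (cl v) ^ Suc i)"
proof -
  let ?x = "\<lambda>v i. real (cl v) ^ Suc i"
  let ?q = "\<lambda>a i. real a ^ Suc i"
  let ?small = "\<lambda>a b u. small_component E h (colour_class cl R a) (colour_class cl R b) u"
  define r where "r a = (SOME v. v \<in> colour_class cl R a)" for a
  have r: "r a \<in> R \<and> cl (r a) = a" if "a < M" for a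
  proof -
    have "\<exists>v. v \<in> colour_class cl R a"
      using size[OF that] \<open>0 < h\<close> by (cases "colour_class cl R a = {}") auto
    then have "r a \<in> colour_class cl R a"
      unfolding r_def by (rule someI_ex)
    then show ?thesis by simp
  qed
  show "spanning d R ?x"
    unfolding spanning_def
  proof (intro exI conjI)
    show "r ` {..d} \<subseteq> R" using r assms(3) by auto
    show "injective_system {..<d} {..<d} (\<lambda>j i. ?x (r (Suc j)) i - ?x (r 0) i)"
      unfolding injective_system_def
    proof (intro allI impI ballI)
      fix w :: "nat \<Rightarrow> real" and i
      assume w: "\<forall>j\<in>{..<d}. (\<Sum>i<d. (?x (r (Suc j)) i - ?x (r 0) i) * w i) = 0" and i: "i \<in> {..<d}"
      show "w i = 0"
      proof (rule moment_curve_general_position[of "Suc ` {..<d}" 0 d])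
        fix b assume "b \<in> Suc ` {..<d}"
        then obtain e where e: "b = Suc e" "e < d" by auto
        then have "(\<Sum>i<d. (?x (r (Suc e)) i - ?x (r 0) i) * w i) = 0" using w by simp
        moreover have "cl (r (Suc e)) = b" "cl (r 0) = 0" using r assms(3) e by auto
        ultimately show "(\<Sum>i<d. (?q 0 i - ?q b i) * w i) = 0"
          by (simp add: left_diff_distrib sum_subtractf sum_negf)
      qed (use i in \<open>auto simp: card_image\<close>)
    qed
  qed
  show "inf_rigid d R E ?x"
    unfolding inf_rigid_def
  proof (intro allI impI)
    fix m assume m: "edge_motion d R E ?x m"
    have giant: "(\<Sum>i<d. (?q a i - ?q b i) * m u i) = (\<Sum>i<d. (?q a i - ?q b i) * m v i)"
      if ab: "a < M" "b < M" "a \<noteq> b" and uv: "\<not> ?small a b u" "\<not> ?small a b v" for a b u v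
    proof -
      have link: "linked E (colour_class cl R a) (colour_class cl R b) u v"
        using assms(1,2) size ab hole uv by (intro large_components_linked) auto
      have "(\<lambda>w. \<Sum>i<d. (?q a i - ?q b i) * m w i)
          \<in> edge_constant E (colour_class cl R a) (colour_class cl R b)"
        unfolding edge_constant_def
      proof (intro CollectI ballI impI)
        fix u v assume "u \<in> colour_class cl R a" "v \<in> colour_class cl R b" "{u, v} \<in> E"
        then have "(\<Sum>i<d. (?q a i - ?q b i) * (m u i - m v i)) = 0"
          using m unfolding edge_motion_def by auto
        then show "(\<Sum>i<d. (?q a i - ?q b i) * m u i) = (\<Sum>i<d. (?q a i - ?q b i) * m v i)"
          by (simp add: right_diff_distrib sum_subtractf)
      qed
      from bspec[OF link[unfolded linked_def] this] show ?thesis .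
    qed
    \<comment> \<open>Each of \<open>u\<close>, \<open>v\<close> is outside the giant component for
      at most \<open>g\<close> colours. At least \<open>M - 1 - 2 * g\<close> colours remain, which
      is at least \<open>d\<close>; the motions of \<open>u\<close> and \<open>v\<close> agree along
      the corresponding directions, and these span.\<close>
    have same: "m u i = m v i" if uv: "u \<in> R" "v \<in> R" "cl u = cl v" and i: "i < d" for u v i
    proof -
      let ?a = "cl u"
      let ?S = "\<lambda>u. {b. b < M \<and> b \<noteq> ?a \<and> ?small ?a b u}"
      let ?B = "{..<M} - {?a} - ?S u - ?S v"
      have "card (?S u) \<le> g" "card (?S v) \<le> g" using few[OF uv(1)] few[OF uv(2)] uv(3) by simp_all
      moreover have "card ({..<M} - {?a}) = M - 1" using cl uv by simp
      moreover have "card ({..<M} - {?a}) - card (?S u) - card (?S v) \<le> card ?B"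
        using diff_card_le_card_Diff[of "?S u" "{..<M} - {?a}"] diff_card_le_card_Diff[of "?S v" "{..<M} - {?a} - ?S u"]
        by simp
      ultimately have "d \<le> card ?B" using assms(3) by linarith
      have "m u i - m v i = 0"
      proof (rule moment_curve_general_position[of ?B ?a d])
        fix b assume "b \<in> ?B"
        then have "(\<Sum>i<d. (?q ?a i - ?q b i) * m u i) = (\<Sum>i<d. (?q ?a i - ?q b i) * m v i)"
          using cl uv by (intro giant) auto
        then show "(\<Sum>i<d. (?q ?a i - ?q b i) * (m u i - m v i)) = 0"
          by (simp add: right_diff_distrib sum_subtractf)
      qed (use i \<open>d \<le> card ?B\<close> in auto)
      then show ?thesis by simp
    qed
    have "\<exists>A c. (\<forall>i j. A i j = - A j i) \<and>
        (\<forall>a<M. \<forall>i<d. m (r a) i = (\<Sum>j<d. A i j * ?q a j) + c i)"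
    proof (rule complete_framework_trivial_motion)
      show "d < M" using assms(3) by simp
      fix a b assume ab: "a < M" "b < M"
      show "(\<Sum>i<d. (?q a i - ?q b i) * (m (r a) i - m (r b) i)) = 0"
      proof (cases "a = b")
        case False
        \<comment> \<open>A representative need not lie in the giant component towards
          \<open>b\<close>. The edge condition is therefore obtained for vertices \<open>u\<close>,
          \<open>v\<close> that do, and transferred by \<open>same\<close>.\<close>
        have few': "card {u \<in> colour_class cl R a. ?small a b u} < h"
          "card {u \<in> colour_class cl R b. ?small a b u} < h"
          using few_in_small_components[of "colour_class cl R a" "colour_class cl R b" h E]
            assms(1,2) size ab hole False by auto
        have "\<exists>u\<in>colour_class cl R a. \<not> ?small a b u"
        proof (rule ccontr)
          assume "\<not> ?thesis"
          then have "{u \<in> colour_class cl R a. ?small a b u} = colour_class cl R a" by auto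
          then show False using few'(1) size[OF ab(1)] by simp
        qed
        moreover have "\<exists>u\<in>colour_class cl R b. \<not> ?small a b u"
        proof (rule ccontr)
          assume "\<not> ?thesis"
          then have "{u \<in> colour_class cl R b. ?small a b u} = colour_class cl R b" by auto
          then show False using few'(2) size[OF ab(2)] by simp
        qed
        ultimately obtain u v where uv: "u \<in> R" "cl u = a" "\<not> ?small a b u" "v \<in> R" "cl v = b" "\<not> ?small a b v"
          by blast
        have "(\<Sum>i<d. (?q a i - ?q b i) * (m (r a) i - m (r b) i)) = (\<Sum>i<d. (?q a i - ?q b i) * (m u i - m v i))"
          using same[of "r a" u] same[of "r b" v] r ab uv by (intro sum.cong refl) simp
        also have "\<dots> = 0"
          using giant[OF ab False uv(3,6)] by (simp add: right_diff_distrib sum_subtractf)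
        finally show ?thesis .
      qed simp
    next
      fix a B w i
      assume "a < M" "B \<subseteq> {..<M} - {a}" "d \<le> card B"
        and "\<And>b. b \<in> B \<Longrightarrow> (\<Sum>i<d. (?q a i - ?q b i) * w i) = 0" and "i < d"
      then show "w i = 0"
        using finite_subset[of B "{..<M} - {a}"] by (intro moment_curve_general_position[of B a d w]) auto
    qed
    then obtain A c where A: "\<And>i j. A i j = - A j i"
      and mr: "\<And>a i. a < M \<Longrightarrow> i < d \<Longrightarrow> m (r a) i = (\<Sum>j<d. A i j * ?q a j) + c i"
      by blast
    have "m v i = (\<Sum>j<d. A i j * ?x v j) + c i" if "v \<in> R" "i < d" for v i
      using mr[of "cl v" i] same[of v "r (cl v)" i] r[of "cl v"] cl that by simp
    then show "trivial_motion d R ?x m"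
      unfolding trivial_motion_def using A by blast
  qed
qed

subsection \<open>Absorbing the remaining vertices\<close>

text \<open>An integer form of connectivity in terms of the two separated sides; the separator is
  the rest of \<open>V\<close>.\<close>

definition well_separated :: "nat \<Rightarrow> 'a set \<Rightarrow> 'a set set \<Rightarrow> bool" where
  "well_separated d V E \<longleftrightarrow>
     (\<forall>X Y. X \<subseteq> V \<longrightarrow> Y \<subseteq> V \<longrightarrow> X \<inter> Y = {} \<longrightarrow> X \<noteq> {} \<longrightarrow> Y \<noteq> {} \<longrightarrow>
        (\<forall>x\<in>X. \<forall>y\<in>Y. {x, y} \<notin> E) \<longrightarrow> card X + card Y + 16 * d * min (card X) (card Y) \<le> card V)"

lemma well_separated_if_f_connected:
  assumes "f_connected f V E" "finite V"
    and f: "\<And>k. k \<ge> 1 \<Longrightarrow> real (16 * d * k) \<le> f k"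
  shows "well_separated d V E"
  unfolding well_separated_def
proof (intro allI impI)
  fix X Y
  assume XY: "X \<subseteq> V" "Y \<subseteq> V" "X \<inter> Y = {}" "X \<noteq> {}" "Y \<noteq> {}" and no: "\<forall>x\<in>X. \<forall>y\<in>Y. {x, y} \<notin> E"
  have fin: "finite X" "finite Y" using XY assms(2) finite_subset by blast+
  have diff: "(V - Y) - (V - X) = X" "(V - X) - (V - Y) = Y" using XY by auto
  have "f (min (card X) (card Y)) \<le> real (card ((V - Y) \<inter> (V - X)))"
    using assms(1)[unfolded f_connected_def, rule_format, of "V - Y" "V - X"] XY no unfolding diff by blast
  moreover have "min (card X) (card Y) \<ge> 1"
    using XY fin by (simp add: Suc_le_eq card_gt_0_iff)
  ultimately have "16 * d * min (card X) (card Y) \<le> card ((V - Y) \<inter> (V - X))"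
    using f[of "min (card X) (card Y)"] by linarith
  moreover have "card V = card ((V - Y) \<inter> (V - X)) + card (X \<union> Y)"
  proof -
    have "V = ((V - Y) \<inter> (V - X)) \<union> (X \<union> Y)" using XY by auto
    then show ?thesis
      using card_Un_disjoint[of "(V - Y) \<inter> (V - X)" "X \<union> Y"] fin assms(2) by auto
  qed
  moreover have "card (X \<union> Y) = card X + card Y"
    using fin XY by (intro card_Un_disjoint)
  ultimately show "card X + card Y + 16 * d * min (card X) (card Y) \<le> card V" by simp
qed

lemma no_bihole_if_well_separated:
  assumes sep: "well_separated d V E" and h: "card V < (16 * d + 2) * h"
    and XY: "X \<subseteq> V" "Y \<subseteq> V" "X \<inter> Y = {}"
  shows "no_bihole E h X Y"
  unfolding no_bihole_def
proof (intro allI impI, rule ccontr)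
  fix P Q assume PQ: "P \<subseteq> X" "Q \<subseteq> Y" "h \<le> card P" "h \<le> card Q" and no: "\<not> (\<exists>x\<in>P. \<exists>y\<in>Q. {x, y} \<in> E)"
  have "h > 0" using h by (cases h) auto
  then have "P \<noteq> {}" "Q \<noteq> {}" using PQ by auto
  then have "card P + card Q + 16 * d * min (card P) (card Q) \<le> card V"
    using sep[unfolded well_separated_def, rule_format, of P Q] PQ XY no by blast
  moreover have "16 * d * h \<le> 16 * d * min (card P) (card Q)"
    using PQ by (intro mult_le_mono2) simp
  ultimately have "card P + card Q + 16 * d * h \<le> card V" by linarith
  then show False
    using h PQ(3,4) by (simp add: add_mult_distrib)
qed

text \<open>Otherwise take \<open>min h (card (V - S))\<close> outside vertices as \<open>X\<close>.
  Their neighbourhood \<open>N\<close> in \<open>S\<close> has at most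
  \<open>(d - 1) * card X\<close> vertices, and \<open>X\<close> is separated from the larger set
  \<open>S - N\<close>. If \<open>card X = h\<close>, the separation bound needs at least
  \<open>(16 * d + 2) * h\<close> vertices, too many. If \<open>X = V - S\<close>, then only
  \<open>N\<close> is left over, too few for a separator.\<close>

lemma absorbable_vertex:
  assumes sep: "well_separated d V E" and "finite V" and h: "card V < (16 * d + 2) * h"
    and "S \<subset> V" and large: "Suc d * h \<le> card S"
  shows "\<exists>v\<in>V - S. d \<le> card {u \<in> S. {v, u} \<in> E}"
proof (rule ccontr)
  assume "\<not> ?thesis"
  then have few: "card {u \<in> S. {v, u} \<in> E} < d" if "v \<in> V - S" for v
    using that by (simp add: not_le)
  have fin: "finite S" "finite (V - S)" using assms(2,4) finite_subset by blast+
  have "h > 0" using h by (cases h) auto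
  have "d > 0" using few assms(4) by fastforce
  obtain X where X: "X \<subseteq> V - S" "card X = min h (card (V - S))"
    by (rule obtain_subset_with_card_n[OF min.cobounded2[of h "card (V - S)"]])
  have finX: "finite X" using X(1) fin finite_subset by blast
  have "V - S \<noteq> {}" using assms(4) by auto
  then have "card X > 0" using X(2) fin \<open>h > 0\<close> by (simp add: card_gt_0_iff)
  define N where "N = (\<Union>v\<in>X. {u \<in> S. {v, u} \<in> E})"
  have "card N \<le> (\<Sum>v\<in>X. card {u \<in> S. {v, u} \<in> E})"
    unfolding N_def by (intro card_UN_le finX)
  also have "\<dots> \<le> (\<Sum>v\<in>X. d - 1)"
    using few X(1) by (intro sum_mono) fastforce
  also have "\<dots> = (d - 1) * card X" by simp
  finally have "card N + card X \<le> d * card X"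
    using \<open>d > 0\<close> by (cases d) auto
  moreover have "N \<subseteq> S" by (auto simp: N_def)
  then have "card (S - N) = card S - card N" "card N \<le> card S"
    using fin(1) by (simp_all add: card_Diff_subset finite_subset card_mono)
  ultimately have SN: "card (S - N) + d * card X \<ge> card S + card X" by linarith
  have "d * card X \<le> d * h" using X(2) by (intro mult_le_mono2) simp
  moreover have "h + d * h \<le> card S" using large by simp
  ultimately have big: "h + card X \<le> card (S - N)"
    using SN by linarith
  have "card X + card (S - N) + 16 * d * min (card X) (card (S - N)) \<le> card V"
  proof (rule sep[unfolded well_separated_def, rule_format])
    have "0 < card (S - N)" using \<open>card X > 0\<close> big by linarith
    then show "X \<noteq> {}" "S - N \<noteq> {}" using \<open>card X > 0\<close> by (simp_all add: card_gt_0_iff)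
    fix x y assume "x \<in> X" "y \<in> S - N"
    then show "{x, y} \<notin> E" by (auto simp: N_def)
  qed (use X(1) assms(4) in auto)
  then have bound: "card X + card (S - N) + 16 * d * card X \<le> card V"
    using big by simp
  have V: "card V = card S + card (V - S)"
    using fin assms(4) by (simp add: card_Diff_subset card_mono psubset_imp_subset assms(2))
  show False
  proof (cases "h \<le> card (V - S)")
    case True
    then have "card X = h" using X(2) by simp
    then show False using bound big h by (simp add: add_mult_distrib)
  next
    case False
    then have "card X = card (V - S)" using X(2) by simp
    then have "card V + 16 * d * card X + card X \<le> card V + d * card X"
      using bound SN V by linarith
    moreover have "d * card X \<le> 16 * d * card X" by simp
    ultimately show False using \<open>card X > 0\<close> by linarith
  qed
qed

text \<open>The new vertex is put at the origin. Its \<open>d\<close> chosen neighbours are moved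
  slightly to become linearly independent; the old part stays rigid by openness, and the
  \<open>d\<close> new edges determine the velocity of the new vertex.\<close>

lemma zero_extension:
  assumes "finite S" and rigid: "inf_rigid d S E x" and span: "spanning d S x"
    and "v \<notin> S" and deg: "d \<le> card {u \<in> S. {v, u} \<in> E}"
  obtains y where "inf_rigid d (insert v S) E y" "spanning d (insert v S) y"
proof -
  obtain T where T: "T \<subseteq> {u \<in> S. {v, u} \<in> E}" "card T = d"
    by (rule obtain_subset_with_card_n[OF deg])
  have "finite T" using T(1) \<open>finite S\<close> by (auto intro: finite_subset)
  then obtain p where p: "bij_betw p {..<d} T"
    using ex_bij_betw_nat_finite[of T] T(2) by (auto simp: lessThan_atLeast0)
  have pT: "p k \<in> S" "{v, p k} \<in> E" if "k < d" for k
    using p T(1) that unfolding bij_betw_def by auto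
  obtain \<epsilon>1 where "\<epsilon>1 > 0" and \<epsilon>1: "\<And>y. (\<And>v i. v \<in> S \<Longrightarrow> i < d \<Longrightarrow> \<bar>y v i - x v i\<bar> < \<epsilon>1) \<Longrightarrow> inf_rigid d S E y"
    using inf_rigid_open[OF \<open>finite S\<close> rigid] by blast
  obtain \<epsilon>2 where "\<epsilon>2 > 0" and \<epsilon>2: "\<And>y. (\<And>v i. v \<in> S \<Longrightarrow> i < d \<Longrightarrow> \<bar>y v i - x v i\<bar> < \<epsilon>2) \<Longrightarrow> spanning d S y"
    using spanning_open[OF span] by blast
  obtain e where e: "0 < e" "e < min \<epsilon>1 \<epsilon>2"
    and inj: "injective_system {..<d} {..<d} (\<lambda>k i. x (p k) i + (if k = i then e else 0))"
    using small_diagonal_shift_injective[of "min \<epsilon>1 \<epsilon>2" d "\<lambda>k. x (p k)"] \<open>\<epsilon>1 > 0\<close> \<open>\<epsilon>2 > 0\<close> by auto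
  \<comment> \<open>Coordinate \<open>i\<close> of the \<open>i\<close>-th neighbour is increased by
    \<open>e\<close>, which is the diagonal shift of the matrix of neighbours.\<close>
  define y where "y u i = (if u = v then 0 else x u i + (if i < d \<and> p i = u then e else 0))" for u i
  have near: "\<bar>y u i - x u i\<bar> < min \<epsilon>1 \<epsilon>2" if "u \<in> S" "i < d" for u i
    using that e \<open>v \<notin> S\<close> by (auto simp: y_def)
  have rigid': "inf_rigid d S E y" using near by (intro \<epsilon>1) auto
  have span': "spanning d S y" using near by (intro \<epsilon>2) auto
  have yp: "y (p k) i = x (p k) i + (if k = i then e else 0)" if "k < d" "i < d" for k i
  proof -
    have "p k \<noteq> v" using pT that \<open>v \<notin> S\<close> by metis
    moreover have "p i = p k \<longleftrightarrow> i = k"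
      using p that by (auto simp: bij_betw_def inj_on_def)
    ultimately show ?thesis using that by (auto simp: y_def)
  qed
  have yv: "y v i = 0" for i by (simp add: y_def)
  show thesis
  proof (rule that)
    show "spanning d (insert v S) y"
      using span' unfolding spanning_def by blast
    show "inf_rigid d (insert v S) E y"
      unfolding inf_rigid_def
    proof (intro allI impI)
      fix m assume m: "edge_motion d (insert v S) E y m"
      then have "edge_motion d S E y m" unfolding edge_motion_def by blast
      then obtain A c where A: "\<And>i j. A i j = - A j i"
        and mS: "\<And>u i. u \<in> S \<Longrightarrow> i < d \<Longrightarrow> m u i = (\<Sum>j<d. A i j * y u j) + c i"
        using rigid' unfolding inf_rigid_def trivial_motion_def by blast
      \<comment> \<open>At the origin the trivial motion has velocity \<open>c\<close>. By skew
        symmetry the edge to each neighbour makes \<open>m v - c\<close> orthogonal to that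
        neighbour, and the neighbours are independent.\<close>
      have "m v i - c i = 0" if "i < d" for i
      proof -
        have "(\<Sum>i<d. (x (p k) i + (if k = i then e else 0)) * (m v i - c i)) = 0" if k: "k < d" for k
        proof -
          have "0 = (\<Sum>i<d. (y v i - y (p k) i) * (m v i - m (p k) i))"
            using m pT[OF k] unfolding edge_motion_def by (simp add: insert_commute)
          also have "\<dots> = (\<Sum>i<d. y (p k) i * (\<Sum>j<d. A i j * y (p k) j)) - (\<Sum>i<d. y (p k) i * (m v i - c i))"
            unfolding sum_subtractf[symmetric]
            using pT[OF k] by (intro sum.cong refl) (simp add: yv mS algebra_simps)
          also have "(\<Sum>i<d. y (p k) i * (\<Sum>j<d. A i j * y (p k) j)) = 0"
            by (rule skew_form_zero[OF A])
          finally show ?thesis using k by (simp add: yp)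
        qed
        then show ?thesis
          using inj[unfolded injective_system_def, rule_format, of "\<lambda>i. m v i - c i" i] that by simp
      qed
      then have "m u i = (\<Sum>j<d. A i j * y u j) + c i" if "u \<in> insert v S" "i < d" for u i
        using that mS by (auto simp: yv)
      then show "trivial_motion d (insert v S) y m"
        unfolding trivial_motion_def using A by blast
    qed
  qed
qed

section \<open>Choice of the parameters and conclusion\<close>

lemma core_class_size:
  fixes d k n r :: nat
  assumes "0 < d" "144 * d \<le> n" "k = n div (16 * d + 2)"
    and "Suc (d div 2) * r \<le> 2 * d * k"
  shows "r + 3 * Suc k + 1 \<le> n div (2 * d + 1)"
proof -
  \<comment> \<open>\<open>r\<close> plays the role of the number of deleted vertices in one class,
    bounded by the double count with \<open>h - 1 = k\<close>. The bound 8 on \<open>k\<close>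
    serves to replace \<open>3 * Suc k + 1\<close> by \<open>4 * k\<close>.\<close>
  have "8 * (16 * d + 2) \<le> n" using assms(1,2) by simp
  then have k8: "8 \<le> k"
    using assms(3) by (simp add: less_eq_div_iff_mult_less_eq)
  have kn: "k * (16 * d + 2) \<le> n"
    unfolding assms(3) by (rule div_times_less_eq_dividend)
  have "Suc d * r \<le> 2 * (Suc (d div 2) * r)"
  proof -
    have "Suc d \<le> 2 * Suc (d div 2)" by presburger
    then have "Suc d * r \<le> 2 * Suc (d div 2) * r" by (rule mult_le_mono1)
    then show ?thesis by simp
  qed
  then have r: "Suc d * r \<le> 4 * d * k" using assms(4) by simp
  have "Suc d * ((r + 4 * k) * (2 * d + 1)) = (Suc d * r + 4 * k * Suc d) * (2 * d + 1)"
    by (simp add: algebra_simps)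
  also have "\<dots> \<le> (4 * d * k + 4 * k * Suc d) * (2 * d + 1)"
    using r by (intro mult_le_mono1 add_le_mono) auto
  also have "\<dots> \<le> Suc d * (k * (16 * d + 2))"
  proof -
    \<comment> \<open>Per factor \<open>k\<close>, the left side is 16 d^2 + 16 d + 4 and the right
      side is 16 d^2 + 18 d + 2; what remains is 2 <= 2 d.\<close>
    have "2 * k \<le> 2 * (d * k)" using assms(1) by simp
    then show ?thesis by (simp add: algebra_simps)
  qed
  also have "\<dots> \<le> Suc d * n" using kn by (intro mult_le_mono2)
  finally have "(r + 4 * k) * (2 * d + 1) \<le> n" by (simp del: mult_Suc)
  then have "r + 4 * k \<le> n div (2 * d + 1)" by (simp add: less_eq_div_iff_mult_less_eq)
  then show ?thesis using k8 by simp
qed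

text \<open>Number the vertices and colour by residues modulo \<open>M\<close>.\<close>

lemma balanced_colouring:
  assumes "finite V" "0 < M"
  obtains cl :: "'a \<Rightarrow> nat" where "\<And>v. cl v < M"
    "\<And>a. a < M \<Longrightarrow> card V div M \<le> card (colour_class cl V a)"
proof -
  obtain \<phi> where \<phi>: "bij_betw \<phi> {..<card V} V"
    using ex_bij_betw_nat_finite[OF assms(1)] by (auto simp: lessThan_atLeast0)
  define cl where "cl v = inv_into {..<card V} \<phi> v mod M" for v
  have inv: "inv_into {..<card V} \<phi> (\<phi> k) = k" if "k < card V" for k
    using \<phi> that by (intro inv_into_f_f) (auto simp: bij_betw_def)
  show thesis
  proof (rule that[of cl])
    show "cl v < M" for v using assms(2) by (simp add: cl_def)
    fix a assume a: "a < M"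
    have bound: "a + j * M < card V" if "j < card V div M" for j
    proof -
      have "a + j * M < Suc j * M" using a by simp
      also have "\<dots> \<le> card V div M * M" using that by (intro mult_le_mono1) simp
      also have "\<dots> \<le> card V" by (rule div_times_less_eq_dividend)
      finally show ?thesis .
    qed
    have "inj_on (\<lambda>j. \<phi> (a + j * M)) {..<card V div M}"
    proof (rule inj_onI)
      fix j j' assume j: "j \<in> {..<card V div M}" "j' \<in> {..<card V div M}" "\<phi> (a + j * M) = \<phi> (a + j' * M)"
      have "a + j * M = inv_into {..<card V} \<phi> (\<phi> (a + j * M))"
        using j by (intro inv[symmetric] bound) simp
      also have "\<dots> = inv_into {..<card V} \<phi> (\<phi> (a + j' * M))"
        using j(3) by (rule arg_cong)
      also have "\<dots> = a + j' * M"
        using j by (intro inv bound) simp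
      finally have "j * M = j' * M" by simp
      then show "j = j'" using mult_cancel2[of j M j'] assms(2) by auto
    qed
    moreover have "(\<lambda>j. \<phi> (a + j * M)) ` {..<card V div M} \<subseteq> colour_class cl V a"
    proof
      fix v assume "v \<in> (\<lambda>j. \<phi> (a + j * M)) ` {..<card V div M}"
      then obtain j where j: "v = \<phi> (a + j * M)" "j < card V div M" by auto
      have "v \<in> V" using \<phi> bound[OF j(2)] j(1) by (auto simp: bij_betw_def)
      moreover have "cl v = a" using inv[OF bound[OF j(2)]] a by (simp add: cl_def j(1))
      ultimately show "v \<in> colour_class cl V a" by simp
    qed
    ultimately show "card V div M \<le> card (colour_class cl V a)"
      using card_inj_on_le[of _ "{..<card V div M}" "colour_class cl V a"] assms(1) by auto
  qed
qed

theorem d_rigid_if_well_separated: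
  assumes sep: "well_separated d V E" and "finite V" and "0 < d" and n: "144 * d \<le> card V"
  shows "d_rigid d V E"
proof -
  \<comment> \<open>\<open>Suc k\<close> is the least \<open>h\<close> with
    \<open>(16 * d + 2) * h\<close> greater than the number of vertices, as the absence of bipartite
    holes requires.\<close>
  define k where "k = card V div (16 * d + 2)"
  \<comment> \<open>Here \<open>2 * ?g + d\<close> is at most \<open>2 * d\<close>, hence less than
    \<open>?M\<close>: any two vertices of a colour share \<open>d\<close> colours towards which
    both are in the giant component.\<close>
  let ?h = "Suc k" and ?M = "2 * d + 1" and ?g = "d div 2"
  let ?good = "\<lambda>S x. inf_rigid d S E x \<and> spanning d S x"
  define P where "P S \<longleftrightarrow> S \<subseteq> V \<and> Suc d * ?h \<le> card S \<and> (\<exists>x. ?good S x)" for S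
  have h: "card V < (16 * d + 2) * ?h"
    unfolding k_def using dividend_less_times_div[of "16 * d + 2" "card V"] by simp
  obtain cl where cl: "\<And>v. cl v < ?M"
    and cs: "\<And>a. a < ?M \<Longrightarrow> card V div ?M \<le> card (colour_class cl V a)"
    using balanced_colouring[OF \<open>finite V\<close>, of ?M] by auto
  have hole: "no_bihole E ?h (colour_class cl V a) (colour_class cl V b)" if "a \<noteq> b" for a b
    using that by (intro no_bihole_if_well_separated[OF sep h]) auto
  obtain R where R: "R \<subseteq> V" and Rsize: "\<And>a. a < ?M \<Longrightarrow> 3 * ?h \<le> card (colour_class cl R a)"
    and few: "\<And>v. v \<in> R \<Longrightarrow> card {b. b < ?M \<and> b \<noteq> cl v \<and>
      small_component E ?h (colour_class cl R (cl v)) (colour_class cl R b) v} \<le> ?g"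
  proof (rule peel[OF \<open>finite V\<close>, of ?h cl ?M E ?g])
    fix a r assume a: "a < ?M" and "Suc ?g * r \<le> (?M - 1) * (?h - 1)"
    then have "Suc (d div 2) * r \<le> 2 * d * k" by simp
    from core_class_size[OF \<open>0 < d\<close> n k_def this] cs[OF a]
    show "r + 3 * ?h + 1 \<le> card (colour_class cl V a)" by linarith
  qed (use cl hole in auto)
  have finR: "finite R" using R \<open>finite V\<close> finite_subset by blast
  have "\<exists>x. ?good R x"
  proof (intro exI conjI)
    have holeR: "no_bihole E ?h (colour_class cl R a) (colour_class cl R b)" if "a \<noteq> b" for a b
      using R by (intro no_bihole_subset[OF hole[OF that]]) auto
    show "inf_rigid d R E (\<lambda>v i. real (cl v) ^ Suc i)" "spanning d R (\<lambda>v i. real (cl v) ^ Suc i)"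
      using finR cl Rsize holeR few \<open>0 < d\<close>
      by (intro inf_rigid_moment_curve[where h = ?h and M = ?M and g = ?g]; simp)+
  qed
  moreover have "Suc d * ?h \<le> card R"
  proof -
    have "Suc d * ?h \<le> ?M * (3 * ?h)" by (intro mult_le_mono) simp_all
    also have "\<dots> = (\<Sum>a<?M. 3 * ?h)" by simp
    also have "\<dots> \<le> (\<Sum>a<?M. card (colour_class cl R a))"
      using Rsize by (intro sum_mono) simp
    also have "\<dots> = card (\<Union>a<?M. colour_class cl R a)"
      using finR by (intro card_UN_disjoint[symmetric]) auto
    also have "\<dots> \<le> card R"
      using finR by (intro card_mono) auto
    finally show ?thesis .
  qed
  ultimately have "P R"
    using R by (simp add: P_def)
  moreover have "\<forall>S. P S \<longrightarrow> card S < Suc (card V)"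
    using \<open>finite V\<close> by (simp add: P_def less_Suc_eq_le card_mono)
  ultimately have "\<exists>S. P S \<and> (\<forall>S'. P S' \<longrightarrow> card S' \<le> card S)"
    by (rule ex_has_greatest_nat)
  then obtain S where "P S" and maximal: "\<And>S'. P S' \<Longrightarrow> card S' \<le> card S"
    by blast
  then have S: "S \<subseteq> V" "Suc d * ?h \<le> card S" "\<exists>x. ?good S x"
    by (simp_all add: P_def)
  have finS: "finite S" using S(1) \<open>finite V\<close> finite_subset by blast
  \<comment> \<open>\<open>S\<close> is a largest set that carries a rigid spanning placement and is
    big enough for absorption; \<open>R\<close> shows that one exists. A missing vertex could be
    absorbed.\<close>
  have "S = V"
  proof (rule ccontr)
    assume "S \<noteq> V"
    then have "S \<subset> V" using S(1) by blast
    from absorbable_vertex[OF sep \<open>finite V\<close> h this S(2)]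
    obtain v where v: "v \<in> V - S" "d \<le> card {u \<in> S. {v, u} \<in> E}"
      by blast
    obtain x where "?good S x" using S(3) by blast
    then have "\<exists>y. ?good (insert v S) y"
      using zero_extension[OF finS, of d E x v] v by blast
    then have "P (insert v S)"
      using v S(1,2) finS by (simp add: P_def)
    then have "card (insert v S) \<le> card S" by (rule maximal)
    then show False using v finS by simp
  qed
  then obtain x where rigid: "inf_rigid d V E x" and span: "spanning d V x" using S(3) by blast
  \<comment> \<open>\<open>x\<close> need not be generic, since whole colour classes start at a
    single point. A generic placement close enough to \<open>x\<close> inherits both
    properties.\<close>
  obtain \<epsilon>1 where "\<epsilon>1 > 0" and \<epsilon>1: "\<And>y. (\<And>v i. v \<in> V \<Longrightarrow> i < d \<Longrightarrow> \<bar>y v i - x v i\<bar> < \<epsilon>1) \<Longrightarrow> inf_rigid d V E y"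
    using inf_rigid_open[OF \<open>finite V\<close> rigid] by blast
  obtain \<epsilon>2 where "\<epsilon>2 > 0" and \<epsilon>2: "\<And>y. (\<And>v i. v \<in> V \<Longrightarrow> i < d \<Longrightarrow> \<bar>y v i - x v i\<bar> < \<epsilon>2) \<Longrightarrow> spanning d V y"
    using spanning_open[OF span] by blast
  obtain p where p: "generic d V p" "\<And>v i. v \<in> V \<Longrightarrow> i < d \<Longrightarrow> \<bar>p v i - x v i\<bar> < min \<epsilon>1 \<epsilon>2"
    using generic_dense[OF \<open>finite V\<close>, of "min \<epsilon>1 \<epsilon>2" d x] \<open>\<epsilon>1 > 0\<close> \<open>\<epsilon>2 > 0\<close> by auto
  have "inf_rigid d V E p" using p(2) by (intro \<epsilon>1) simp
  moreover have "spanning d V p" using p(2) by (intro \<epsilon>2) simp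
  ultimately have "rigid_framework d V E p"
    by (intro rigid_framework_if_inf_rigid \<open>finite V\<close>)
  then show ?thesis using p(1) unfolding d_rigid_def by blast
qed

theorem corollary1p9:
  fixes C :: real and n :: nat and f :: "nat \<Rightarrow> real"
    and V :: "'a set" and E :: "'a set set"
  assumes "C > 16" and "real n \<ge> 9 * C"
    and "\<And>k. k \<ge> 1 \<Longrightarrow> f k = C * real k"
    and "simple_graph V E" and "card V = n"
    and "f_connected f V E"
  shows "d_rigid (nat \<lfloor>C / 16\<rfloor>) V E"
proof (rule d_rigid_if_well_separated)
  let ?d = "nat \<lfloor>C / 16\<rfloor>"
  show V: "finite V" using assms(4) by (simp add: simple_graph_def)
  \<comment> \<open>Rounding \<open>C / 16\<close> down only weakens the separation bound, and it
    yields 144 d <= 9 C <= n.\<close>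
  have d: "real (16 * ?d) \<le> C"
    using assms(1) of_int_floor_le[of "C / 16"] by simp
  show "0 < ?d" using assms(1) by simp
  show "144 * ?d \<le> card V"
    using d assms(2,5) by linarith
  show "well_separated ?d V E"
  proof (rule well_separated_if_f_connected[OF assms(6) V])
    fix k :: nat assume "k \<ge> 1"
    have "real (16 * ?d) * real k \<le> C * real k"
      using d by (intro mult_right_mono) auto
    then show "real (16 * ?d * k) \<le> f k"
      using assms(3)[OF \<open>k \<ge> 1\<close>] by simp
  qed
qed

end
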